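(* Let $n$ be a positive even integer and let $c_1,\ldots,c_n\in\mathbf{C}$, where $c_n$ has positive real and imaginary parts. Let $H$ be some closed extension in $L^2(\mathbf{R})$ of the operator $$H:=P^2+\sum_{m=1}^{n}c_mQ^m,\qquad\text{i.e.}\qquad Hf(x)=-\frac{\mathrm{d}^2f}{\mathrm{d}x^2}(x)+\sum_{m=1}^{n}c_mx^mf(x),$$ initially defined on $C_c^\infty(\mathbf{R})$. If $z\in\mathbf{C}$ satisfies $0<\arg(z)<\arg(c_n)$ and $\sigma>0$, then $$\Vert(H-\sigma zI)^{-1}\Vert$$ diverges to infinity faster than any power of $\sigma$ as $\sigma\to+\infty$; that is, for every $k>0$, $\sigma^{-k}\Vert(H-\sigma zI)^{-1}\Vert\to\infty$ as $\sigma\to+\infty$.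
   Context: Quantum mechanical notation: $P=-i\,\mathrm{d}/\mathrm{d}x$, so that $P^2=-\mathrm{d}^2/\mathrm{d}x^2$, and $Q$ is multiplication by $x$. $\Vert(H-wI)^{-1}\Vert$ is the operator norm on $L^2(\mathbf{R})$ of the resolvent, with the convention that it equals $+\infty$ if $w$ lies in the spectrum of $H$. $\arg$ is the principal argument, so $0<\arg(c_n)<\pi/2$. *)

theory Defs
  imports "HOL-Analysis.Analysis"
begin

definition square_integrable :: "(real \<Rightarrow> complex) \<Rightarrow> bool" where
  "square_integrable f \<longleftrightarrow>
     f \<in> borel_measurable lborel \<and> integrable lborel (\<lambda>x. (cmod (f x))\<^sup>2)"

definition l2_rel :: "(real \<Rightarrow> complex) \<Rightarrow> (real \<Rightarrow> complex) \<Rightarrow> bool" where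
  "l2_rel f g \<longleftrightarrow> square_integrable f \<and> square_integrable g \<and> (AE x in lborel. f x = g x)"

lemma square_integrable_measurable [measurable_dest]:
  "square_integrable f \<Longrightarrow> f \<in> borel_measurable lborel"
  by (simp add: square_integrable_def)

lemma square_integrable_zero: "square_integrable (\<lambda>x. 0)"
  by (simp add: square_integrable_def)

lemma square_integrable_add:
  assumes "square_integrable f" "square_integrable g"
  shows "square_integrable (\<lambda>x. f x + g x)"
proof -
  have [measurable]: "f \<in> borel_measurable lborel" "g \<in> borel_measurable lborel"
    using assms by (auto simp: square_integrable_def)
  have "integrable lborel (\<lambda>x. (cmod (f x + g x))\<^sup>2)"
  proof (rule Bochner_Integration.integrable_bound)
    show "integrable lborel (\<lambda>x. 2 * (cmod (f x))\<^sup>2 + 2 * (cmod (g x))\<^sup>2)"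
      using assms by (auto simp: square_integrable_def)
    have "(cmod (a + b))\<^sup>2 \<le> 2 * (cmod a)\<^sup>2 + 2 * (cmod b)\<^sup>2" for a b
    proof -
      have "(cmod (a + b))\<^sup>2 \<le> (cmod a + cmod b)\<^sup>2"
        by (intro power_mono norm_triangle_ineq) auto
      also have "\<dots> \<le> 2 * (cmod a)\<^sup>2 + 2 * (cmod b)\<^sup>2"
        using sum_squares_bound[of "cmod a" "cmod b"] by (simp add: power2_sum)
      finally show ?thesis .
    qed
    then show "AE x in lborel. norm ((cmod (f x + g x))\<^sup>2)
        \<le> norm (2 * (cmod (f x))\<^sup>2 + 2 * (cmod (g x))\<^sup>2)"
      by simp
  qed simp
  then show ?thesis by (simp add: square_integrable_def)
qed

lemma square_integrable_scale:
  "square_integrable f \<Longrightarrow> square_integrable (\<lambda>x. a * f x)"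
  by (auto simp: square_integrable_def norm_mult power_mult_distrib)

lemma square_integrable_cong_AE:
  assumes "square_integrable f" "g \<in> borel_measurable lborel" "AE x in lborel. f x = g x"
  shows "square_integrable g"
proof -
  have [measurable]: "f \<in> borel_measurable lborel" "g \<in> borel_measurable lborel"
    using assms by (auto simp: square_integrable_def)
  have "integrable lborel (\<lambda>x. (cmod (g x))\<^sup>2) \<longleftrightarrow> integrable lborel (\<lambda>x. (cmod (f x))\<^sup>2)"
    using assms(3) by (intro integrable_cong_AE) auto
  then show ?thesis using assms by (simp add: square_integrable_def)
qed

lemma square_integrable_inner:
  assumes "square_integrable f" "square_integrable g"
  shows "integrable lborel (\<lambda>x. Re (f x * cnj (g x)))"
proof (rule Bochner_Integration.integrable_bound)
  have [measurable]: "f \<in> borel_measurable lborel" "g \<in> borel_measurable lborel"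
    using assms by (auto simp: square_integrable_def)
  show "(\<lambda>x. Re (f x * cnj (g x))) \<in> borel_measurable lborel"
    by (simp add: complex_eq_iff)
  show "integrable lborel (\<lambda>x. (cmod (f x))\<^sup>2 + (cmod (g x))\<^sup>2)"
    using assms by (auto simp: square_integrable_def)
  have "\<bar>Re (a * cnj b)\<bar> \<le> (cmod a)\<^sup>2 + (cmod b)\<^sup>2" for a b
  proof -
    have "\<bar>Re (a * cnj b)\<bar> \<le> cmod a * cmod b"
      using abs_Re_le_cmod[of "a * cnj b"] by (simp add: norm_mult)
    moreover have "0 \<le> cmod a * cmod b" by simp
    ultimately show ?thesis
      using sum_squares_bound[of "cmod a" "cmod b"] by linarith
  qed
  then show "AE x in lborel. norm (Re (f x * cnj (g x)))
      \<le> norm ((cmod (f x))\<^sup>2 + (cmod (g x))\<^sup>2)"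
    by simp
qed

quotient_type l2 = "real \<Rightarrow> complex" / partial: l2_rel
proof (rule part_equivpI)
  show "\<exists>f. l2_rel f f"
    using square_integrable_zero by (auto simp: l2_rel_def)
  show "symp l2_rel"
    by (auto simp: symp_def l2_rel_def)
  show "transp l2_rel"
    unfolding transp_def l2_rel_def by (auto elim: AE_mp)
qed

instantiation l2 :: real_inner
begin

lift_definition zero_l2 :: l2 is "\<lambda>x. 0"
  by (simp add: l2_rel_def square_integrable_zero)

lift_definition plus_l2 :: "l2 \<Rightarrow> l2 \<Rightarrow> l2" is "\<lambda>f g x. f x + g x"
  by (auto simp: l2_rel_def square_integrable_add)

lift_definition uminus_l2 :: "l2 \<Rightarrow> l2" is "\<lambda>f x. - f x"
  using square_integrable_scale[of _ "-1"] by (auto simp: l2_rel_def)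

lift_definition scaleR_l2 :: "real \<Rightarrow> l2 \<Rightarrow> l2" is "\<lambda>r f x. complex_of_real r * f x"
  by (auto simp: l2_rel_def square_integrable_scale)

lift_definition inner_l2 :: "l2 \<Rightarrow> l2 \<Rightarrow> real" is
  "\<lambda>f g. (LINT x|lborel. Re (f x * cnj (g x)))"
proof -
  fix f f' g g' assume "l2_rel f f'" "l2_rel g g'"
  then have "square_integrable f" "square_integrable f'" "square_integrable g"
    "square_integrable g'" and ae: "AE x in lborel. f x = f' x" "AE x in lborel. g x = g' x"
    by (auto simp: l2_rel_def)
  then have m: "(\<lambda>x. Re (f x * cnj (g x))) \<in> borel_measurable lborel"
    "(\<lambda>x. Re (f' x * cnj (g' x))) \<in> borel_measurable lborel"
    using square_integrable_inner by (blast dest: borel_measurable_integrable)+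
  show "(LINT x|lborel. Re (f x * cnj (g x))) = (LINT x|lborel. Re (f' x * cnj (g' x)))"
    by (rule integral_cong_AE[OF m]) (use ae in auto)
qed

lift_definition norm_l2 :: "l2 \<Rightarrow> real" is
  "\<lambda>f. sqrt (LINT x|lborel. (cmod (f x))\<^sup>2)"
proof -
  fix f g assume *: "l2_rel f g"
  then have [measurable]: "f \<in> borel_measurable lborel" "g \<in> borel_measurable lborel"
    by (auto simp: l2_rel_def square_integrable_def)
  from * have "AE x in lborel. f x = g x" by (simp add: l2_rel_def)
  then have "(LINT x|lborel. (cmod (f x))\<^sup>2) = (LINT x|lborel. (cmod (g x))\<^sup>2)"
    by (intro integral_cong_AE) auto
  then show "sqrt (LINT x|lborel. (cmod (f x))\<^sup>2) = sqrt (LINT x|lborel. (cmod (g x))\<^sup>2)"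
    by simp
qed

definition minus_l2 :: "l2 \<Rightarrow> l2 \<Rightarrow> l2" where "minus_l2 f g = f + - g"
definition sgn_l2 :: "l2 \<Rightarrow> l2" where "sgn_l2 f = scaleR (inverse (norm f)) f"
definition dist_l2 :: "l2 \<Rightarrow> l2 \<Rightarrow> real" where "dist_l2 f g = norm (f - g)"
definition uniformity_l2 :: "(l2 \<times> l2) filter" where
  "uniformity_l2 = (INF e\<in>{0<..}. principal {(f, g). dist f g < e})"
definition open_l2 :: "l2 set \<Rightarrow> bool" where
  "open_l2 U \<longleftrightarrow> (\<forall>f\<in>U. \<forall>\<^sub>F (f', g) in uniformity. f' = f \<longrightarrow> g \<in> U)"

instance
proof
  fix f g h :: l2 and a b :: real
  show "f + g + h = f + (g + h)"
    by transfer (auto simp: l2_rel_def square_integrable_add add.assoc)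
  show "f + g = g + f"
    by transfer (auto simp: l2_rel_def square_integrable_add add.commute)
  show "0 + f = f"
    by transfer (auto simp: l2_rel_def)
  show "- f + f = 0"
    by transfer (auto simp: l2_rel_def square_integrable_zero)
  show "f - g = f + - g"
    by (simp add: minus_l2_def)
  show "a *\<^sub>R (f + g) = a *\<^sub>R f + a *\<^sub>R g"
    by transfer (auto simp: l2_rel_def square_integrable_add square_integrable_scale
        simp flip: distrib_left)
  show "(a + b) *\<^sub>R f = a *\<^sub>R f + b *\<^sub>R f"
    by transfer (auto simp: l2_rel_def square_integrable_scale
        simp flip: distrib_right of_real_add)
  show "a *\<^sub>R b *\<^sub>R f = (a * b) *\<^sub>R f"
    by transfer (auto simp: l2_rel_def square_integrable_scale mult.assoc
        intro: square_integrable_scale[where a = "_ * _", simplified mult.assoc])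
  show "1 *\<^sub>R f = f"
    by transfer (auto simp: l2_rel_def)
  show "sgn f = scaleR (inverse (norm f)) f" by (rule sgn_l2_def)
  show "dist f g = norm (f - g)" by (rule dist_l2_def)
  show "uniformity = (INF e\<in>{0<..}. principal {(f :: l2, g). dist f g < e})"
    by (rule uniformity_l2_def)
  show "open U \<longleftrightarrow> (\<forall>f\<in>U. \<forall>\<^sub>F (f', g) in uniformity. f' = f \<longrightarrow> g \<in> U)" for U :: "l2 set"
    by (rule open_l2_def)
  show "inner f g = inner g f"
    by transfer (simp add: mult.commute)
  show "inner (f + g) h = inner f h + inner g h"
  proof transfer
    fix f g h assume "l2_rel f f" "l2_rel g g" "l2_rel h h"
    then have "square_integrable f" "square_integrable g" "square_integrable h"
      by (auto simp: l2_rel_def)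
    then have "(LINT x|lborel. Re (f x * cnj (h x)) + Re (g x * cnj (h x))) =
        (LINT x|lborel. Re (f x * cnj (h x))) + (LINT x|lborel. Re (g x * cnj (h x)))"
      by (intro Bochner_Integration.integral_add square_integrable_inner)
    then show "(LINT x|lborel. Re ((f x + g x) * cnj (h x))) =
        (LINT x|lborel. Re (f x * cnj (h x))) + (LINT x|lborel. Re (g x * cnj (h x)))"
      by (simp only: distrib_right plus_complex.sel)
  qed
  show "inner (a *\<^sub>R f) g = a * inner f g"
  proof transfer
    fix a :: real and f g :: "real \<Rightarrow> complex"
    have "(\<lambda>x. Re (complex_of_real a * f x * cnj (g x))) = (\<lambda>x. a * Re (f x * cnj (g x)))"
      by (simp add: fun_eq_iff algebra_simps)
    then show "(LINT x|lborel. Re (complex_of_real a * f x * cnj (g x))) =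
        a * (LINT x|lborel. Re (f x * cnj (g x)))"
      by simp
  qed
  have Re_mult_cnj: "Re (w * cnj w) = (cmod w)\<^sup>2" for w
    unfolding cmod_power2 by (simp add: power2_eq_square)
  show "0 \<le> inner f f"
    by transfer (simp only: Re_mult_cnj, simp)
  show "inner f f = 0 \<longleftrightarrow> f = 0"
  proof transfer
    fix f assume "l2_rel f f"
    then have "square_integrable f" by (simp add: l2_rel_def)
    moreover have "(LINT x|lborel. (cmod (f x))\<^sup>2) = 0 \<longleftrightarrow> (AE x in lborel. (cmod (f x))\<^sup>2 = 0)"
      using \<open>square_integrable f\<close>
      by (intro integral_nonneg_eq_0_iff_AE) (auto simp: square_integrable_def)
    ultimately show "((LINT x|lborel. Re (f x * cnj (f x))) = 0) = l2_rel f (\<lambda>x. 0)"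
      by (simp only: Re_mult_cnj) (auto simp: l2_rel_def square_integrable_zero)
  qed
  show "norm f = sqrt (inner f f)"
    by transfer (simp only: Re_mult_cnj)
qed

end

text \<open>The class \<open>real_inner\<close> provides the norm and the topology of \<open>L\<^sup>2(\<real>)\<close>; its inner product is
  the real part of the usual sesquilinear one. The complex structure is the following scalar
  multiplication.\<close>

lift_definition scaleC :: "complex \<Rightarrow> l2 \<Rightarrow> l2" is "\<lambda>a f x. a * f x"
  by (auto simp: l2_rel_def square_integrable_scale)

global_interpretation l2: vector_space scaleC
proof
  fix a b :: complex and f g :: l2
  show "scaleC a (f + g) = scaleC a f + scaleC a g"
    by transfer (auto simp: l2_rel_def square_integrable_add square_integrable_scale
        simp flip: distrib_left)
  show "scaleC (a + b) f = scaleC a f + scaleC b f"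
    by transfer (auto simp: l2_rel_def square_integrable_scale simp flip: distrib_right)
  show "scaleC a (scaleC b f) = scaleC (a * b) f"
    by transfer (auto simp: l2_rel_def square_integrable_scale simp flip: mult.assoc)
  show "scaleC 1 f = f"
    by transfer (auto simp: l2_rel_def)
qed

text \<open>An unbounded operator is given by its domain \<open>D\<close> and a total function \<open>T\<close> of which only the
  values on \<open>D\<close> matter.\<close>

definition linear_operator :: "l2 set \<Rightarrow> (l2 \<Rightarrow> l2) \<Rightarrow> bool" where
  "linear_operator D T \<longleftrightarrow>
     l2.subspace D \<and>
     (\<forall>f\<in>D. \<forall>g\<in>D. T (f + g) = T f + T g) \<and>
     (\<forall>a. \<forall>f\<in>D. T (scaleC a f) = scaleC a (T f))"

definition closed_operator :: "l2 set \<Rightarrow> (l2 \<Rightarrow> l2) \<Rightarrow> bool" where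
  "closed_operator D T \<longleftrightarrow> linear_operator D T \<and> closed ((\<lambda>f. (f, T f)) ` D)"

definition shifted :: "(l2 \<Rightarrow> l2) \<Rightarrow> complex \<Rightarrow> l2 \<Rightarrow> l2" where
  "shifted T w = (\<lambda>f. T f - scaleC w f)"

definition resolvent :: "l2 set \<Rightarrow> (l2 \<Rightarrow> l2) \<Rightarrow> complex \<Rightarrow> l2 \<Rightarrow> l2" where
  "resolvent D T w = the_inv_into D (shifted T w)"

definition spectrum :: "l2 set \<Rightarrow> (l2 \<Rightarrow> l2) \<Rightarrow> complex set" where
  "spectrum D T =
     {w. \<not> (bij_betw (shifted T w) D UNIV \<and> bounded_linear (resolvent D T w))}"

definition resolvent_norm :: "l2 set \<Rightarrow> (l2 \<Rightarrow> l2) \<Rightarrow> complex \<Rightarrow> ereal" where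
  "resolvent_norm D T w = (if w \<in> spectrum D T then \<infinity> else ereal (onorm (resolvent D T w)))"

definition vderiv :: "(real \<Rightarrow> complex) \<Rightarrow> real \<Rightarrow> complex" where
  "vderiv f = (\<lambda>x. vector_derivative f (at x))"

definition test_function :: "(real \<Rightarrow> complex) \<Rightarrow> bool" where
  "test_function f \<longleftrightarrow>
     (\<forall>k x. (vderiv ^^ k) f differentiable (at x)) \<and> compact (closure (support_on UNIV f))"

definition schrodinger :: "nat \<Rightarrow> (nat \<Rightarrow> complex) \<Rightarrow> (real \<Rightarrow> complex) \<Rightarrow> real \<Rightarrow> complex" where
  "schrodinger n c f = (\<lambda>x. - (vderiv ^^ 2) f x + (\<Sum>m=1..n. c m * of_real x ^ m * f x))"

text \<open>\<open>abs_l2\<close> is meaningful only on square integrable functions; the next lemmas show that it is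
  applied to such functions in \<open>closed_schrodinger_extension\<close> below.\<close>

lemma square_integrable_continuous_compact_support:
  fixes f :: "real \<Rightarrow> complex"
  assumes "continuous_on UNIV f" "compact K" "\<And>x. x \<notin> K \<Longrightarrow> f x = 0"
  shows "square_integrable f"
proof -
  have "integrable lborel (\<lambda>x. indicator K x *\<^sub>R (cmod (f x))\<^sup>2)"
    using assms(1,2)
    by (intro borel_integrable_compact continuous_intros) (auto intro: continuous_on_subset)
  moreover have "(\<lambda>x. indicator K x *\<^sub>R (cmod (f x))\<^sup>2) = (\<lambda>x. (cmod (f x))\<^sup>2)"
    using assms(3) by (auto simp: fun_eq_iff indicator_def)
  ultimately show ?thesis
    using assms(1) by (simp add: square_integrable_def borel_measurable_continuous_onI)
qed

lemma test_function_continuous: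
  assumes "test_function f"
  shows "continuous_on UNIV ((vderiv ^^ k) f)"
  using assms
  by (auto simp: test_function_def continuous_on_eq_continuous_at differentiable_imp_continuous_within)

lemma test_function_support:
  assumes "x \<notin> closure (support_on UNIV f)"
  shows "(vderiv ^^ k) f x = 0"
  using assms
proof (induction k arbitrary: x)
  case 0
  then show ?case
    using closure_subset[of "support_on UNIV f"] by (auto simp: support_on_def)
next
  case (Suc k)
  have "((vderiv ^^ k) f has_vector_derivative 0) (at x)"
  proof (rule has_vector_derivative_transform_within_open)
    show "((\<lambda>x. 0) has_vector_derivative 0) (at x)" by simp
    show "open (- closure (support_on UNIV f))" by (intro open_Compl closed_closure)
  qed (use Suc in auto)
  then have "vderiv ((vderiv ^^ k) f) x = 0"
    unfolding vderiv_def[of "(vderiv ^^ k) f"] by (rule vector_derivative_at)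
  then show ?case by simp
qed

lemma test_function_square_integrable:
  assumes "test_function f"
  shows "square_integrable f"
  using assms test_function_continuous[OF assms, of 0] test_function_support[of _ f 0]
  by (intro square_integrable_continuous_compact_support[of _ "closure (support_on UNIV f)"])
    (auto simp: test_function_def)

lemma schrodinger_square_integrable:
  assumes "test_function f"
  shows "square_integrable (schrodinger n c f)"
proof (rule square_integrable_continuous_compact_support)
  show "continuous_on UNIV (schrodinger n c f)"
    unfolding schrodinger_def
    using test_function_continuous[OF assms, of 0] test_function_continuous[OF assms, of 2]
    by (intro continuous_intros) auto
  show "compact (closure (support_on UNIV f))"
    using assms by (simp add: test_function_def)
  show "schrodinger n c f x = 0" if "x \<notin> closure (support_on UNIV f)" for x
    using test_function_support[OF that, of 0] test_function_support[OF that, of 2]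
    by (simp add: schrodinger_def)
qed

definition closed_schrodinger_extension ::
    "nat \<Rightarrow> (nat \<Rightarrow> complex) \<Rightarrow> l2 set \<Rightarrow> (l2 \<Rightarrow> l2) \<Rightarrow> bool" where
  "closed_schrodinger_extension n c D H \<longleftrightarrow>
     closed_operator D H \<and>
     (\<forall>f. test_function f \<longrightarrow> abs_l2 f \<in> D \<and> H (abs_l2 f) = abs_l2 (schrodinger n c f))"

end

theory Submission
  imports Defs "HOL-Computational_Algebra.Polynomial" "HOL-Real_Asymp.Real_Asymp"
begin

text \<open>
  If a function \<open>f\<close> in the domain satisfies \<open>\<parallel>(H - w) f\<parallel> \<le> \<delta> \<parallel>f\<parallel>\<close>, then \<open>\<parallel>(H - w)\<^sup>-\<^sup>1\<parallel> \<ge> 1 / \<delta>\<close> or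
  \<open>w\<close> is in the spectrum. So it suffices to produce, for \<open>w = \<sigma> z\<close> and every power of \<open>\<sigma>\<close>, test
  functions whose residual is small relative to that power. These are complex Gaussian wave
  packets times polynomials, multiplied by a smooth cutoff.

  Write \<open>n = 2 m\<close>, \<open>\<sigma> = r ^ (2 n)\<close> and \<open>x = r\<^sup>2 (a + \<zeta>)\<close>. Then \<open>V x - \<sigma> z = \<sigma> W \<zeta>\<close>, where the
  polynomial \<open>W\<close> converges to \<open>c\<^sub>n (a + \<zeta>) ^ n - z\<close> as \<open>r \<rightarrow> \<infinity>\<close>. The condition \<open>0 < Arg z < Arg
  c\<^sub>n\<close> is what allows \<open>a > 0\<close> to be chosen with \<open>W 0 = - \<eta>\<^sup>2\<close> real and negative: the symbol \<open>\<xi>\<^sup>2 + W\<close>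
  vanishes at the real phase space point \<open>(a, \<eta>)\<close>. Moreover \<open>Im W' 0 > 0\<close> for large \<open>r\<close>,
  because \<open>a > 0\<close> and \<open>Im c\<^sub>n > 0\<close>.
  With \<open>\<epsilon> = r ^ -(m + 1)\<close> and \<open>\<zeta> = \<epsilon> t\<close> the operator becomes \<open>\<sigma> (- \<epsilon>\<^sup>2 d\<^sup>2/dt\<^sup>2 + W (\<epsilon> t))\<close>. On \<open>p
  t * exp (\<i> \<eta> t / \<epsilon> - b t\<^sup>2 / 2)\<close> with \<open>b = - W' 0 / (2 \<i> \<eta>)\<close> the terms of order \<open>1\<close>, and those
  of order \<open>\<epsilon>\<close> that do not contain a derivative of \<open>p\<close>, cancel. There remains the action \<open>\<epsilon> (\<epsilon> M p
  - 2 \<i> \<eta> p')\<close> on the polynomial \<open>p\<close>, where \<open>M\<close> maps polynomials to polynomials (\<open>transport_op\<close>,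
  \<open>conjugated_operator\<close>). The sign condition \<open>Re b > 0\<close> holds for the root \<open>\<eta> < 0\<close>.

  Since every polynomial has a polynomial antiderivative, \<open>2 \<i> \<eta> p' = \<epsilon> M p\<close> can be solved by
  iteration from \<open>p = 1\<close> up to an error of any order in \<open>\<epsilon>\<close> (\<open>transport_equation_amplitude\<close>). All
  the data of the construction converge as \<open>r \<rightarrow> \<infinity>\<close>, so polynomials times Gaussians are bounded
  uniformly in \<open>r\<close> (\<open>poly_tendsto_gauss_bound\<close>). The cutoff lives at distance \<open>1 / \<rho>\<close> with \<open>\<rho>\<close> a
  high power of \<open>\<epsilon>\<close>: its derivatives contribute only \<open>O(\<rho>\<^sup>2)\<close>, and on such a support a supremum
  bound costs only a factor \<open>\<rho> powr (- 1 / 2)\<close> when passing to \<open>L\<^sup>2\<close> norms, so no Gaussian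
  integral has to be evaluated. As the order of the iteration is at our disposal, the resolvent
  norm exceeds every power of \<open>\<sigma>\<close> (\<open>resolvent_norm_ge_power\<close>).
\<close>

section \<open>Lower bounds for resolvents from test functions\<close>

lemma resolvent_norm_ge:
  assumes "u \<in> D" "norm (shifted H w u) \<le> B" "B > 0"
  shows "ereal (norm u / B) \<le> resolvent_norm D H w"
proof (cases "w \<in> spectrum D H")
  case True
  then show ?thesis by (simp add: resolvent_norm_def)
next
  case False
  then have bij: "bij_betw (shifted H w) D UNIV" and bl: "bounded_linear (resolvent D H w)"
    by (auto simp: spectrum_def)
  have "resolvent D H w (shifted H w u) = u"
    unfolding resolvent_def using bij assms(1) by (auto simp: bij_betw_def the_inv_into_f_f)
  then have "norm u \<le> onorm (resolvent D H w) * norm (shifted H w u)"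
    using onorm[OF bl, of "shifted H w u"] by simp
  also have "\<dots> \<le> onorm (resolvent D H w) * B"
    using assms(2) onorm_pos_le[OF bl] by (rule mult_left_mono)
  finally show ?thesis
    using False \<open>B > 0\<close> by (simp add: resolvent_norm_def field_simps)
qed

lemma norm_abs_l2: "square_integrable f \<Longrightarrow> norm (abs_l2 f) = sqrt (LINT x|lborel. (cmod (f x))\<^sup>2)"
  by (simp add: norm_l2.abs_eq l2_rel_def)

lemma diff_scaleC_abs_l2:
  assumes "square_integrable f" "square_integrable g"
  shows "abs_l2 g - scaleC w (abs_l2 f) = abs_l2 (\<lambda>x. g x - w * f x)"
proof -
  have "l2_rel f f" "l2_rel g g" "l2_rel (\<lambda>x. w * f x) (\<lambda>x. w * f x)"
    "l2_rel (\<lambda>x. - (w * f x)) (\<lambda>x. - (w * f x))"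
    using assms square_integrable_scale[of f "w"] square_integrable_scale[of f "- w"]
    by (simp_all add: l2_rel_def)
  then show ?thesis
    by (simp add: minus_l2_def scaleC.abs_eq uminus_l2.abs_eq plus_l2.abs_eq)
qed

lemma square_integrable_diff:
  assumes "square_integrable f" "square_integrable g"
  shows "square_integrable (\<lambda>x. f x - g x)"
  using square_integrable_add[OF assms(1) square_integrable_scale[OF assms(2), of "-1"]] by simp

lemma norm_abs_l2_le:
  assumes f: "square_integrable f" and l: "l > 0" and M: "M \<ge> 0"
    and supp: "\<And>x. \<bar>x - y\<bar> > l \<Longrightarrow> f x = 0" and bd: "\<And>x. cmod (f x) \<le> M"
  shows "norm (abs_l2 f) \<le> sqrt (2 * l) * M"
proof -
  have "(LINT x|lborel. (cmod (f x))\<^sup>2) \<le> (LINT x|lborel. indicator {y - l..y + l} x * M\<^sup>2)"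
  proof (rule integral_mono)
    show "integrable lborel (\<lambda>x. (cmod (f x))\<^sup>2)"
      using f by (simp add: square_integrable_def)
    show "integrable lborel (\<lambda>x. indicator {y - l..y + l} x * M\<^sup>2 :: real)"
      by (intro integrable_mult_left integrable_real_indicator) (auto simp: emeasure_lborel_Icc_eq)
    fix x :: real
    show "(cmod (f x))\<^sup>2 \<le> indicator {y - l..y + l} x * M\<^sup>2"
      using supp[of x] power_mono[OF bd[of x], of 2] by (auto simp: indicator_def abs_if split: if_splits)
  qed
  also have "\<dots> = (2 * l) * M\<^sup>2"
    using l by simp
  finally show ?thesis
    using l M by (auto simp: norm_abs_l2[OF f] real_sqrt_mult intro!: real_le_lsqrt simp: power_mult_distrib)
qed

lemma norm_abs_l2_ge:
  assumes f: "square_integrable f" and l: "l > 0" and M: "M \<ge> 0"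
    and bd: "\<And>x. \<bar>x - y\<bar> \<le> l \<Longrightarrow> M \<le> cmod (f x)"
  shows "sqrt (2 * l) * M \<le> norm (abs_l2 f)"
proof -
  have "(2 * l) * M\<^sup>2 = (LINT x|lborel. indicator {y - l..y + l} x * M\<^sup>2)"
    using l by simp
  also have "\<dots> \<le> (LINT x|lborel. (cmod (f x))\<^sup>2)"
  proof (rule integral_mono)
    show "integrable lborel (\<lambda>x. (cmod (f x))\<^sup>2)"
      using f by (simp add: square_integrable_def)
    show "integrable lborel (\<lambda>x. indicator {y - l..y + l} x * M\<^sup>2 :: real)"
      by (intro integrable_mult_left integrable_real_indicator) (auto simp: emeasure_lborel_Icc_eq)
    fix x :: real
    show "indicator {y - l..y + l} x * M\<^sup>2 \<le> (cmod (f x))\<^sup>2"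
      using power_mono[OF bd[of x] M, of 2] by (auto simp: indicator_def abs_if split: if_splits)
  qed
  finally show ?thesis
    using l M by (auto simp: norm_abs_l2[OF f] power_mult_distrib intro!: real_le_rsqrt)
qed

text \<open>Only pointwise bounds enter: the residual is a compactly supported function like \<open>f\<close>, so
  suprema over the support control its \<open>L\<^sup>2\<close> norm. The intervals, of half lengths \<open>l\<close> and \<open>l'\<close>,
  account for the square roots.\<close>

lemma resolvent_norm_ge_test_function:
  assumes H: "closed_schrodinger_extension n c D H" and f: "test_function f"
    and l: "l > 0" "l' > 0" and M: "M > 0" "M' \<ge> 0"
    and supp: "\<And>x. \<bar>x - y\<bar> > l \<Longrightarrow> f x = 0"
    and small: "\<And>x. cmod (schrodinger n c f x - w * f x) \<le> M"
    and large: "\<And>x. \<bar>x - y\<bar> \<le> l' \<Longrightarrow> M' \<le> cmod (f x)"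
  shows "ereal (sqrt (2 * l') * M' / (sqrt (2 * l) * M)) \<le> resolvent_norm D H w"
proof -
  let ?g = "\<lambda>x. schrodinger n c f x - w * f x"
  have sf: "square_integrable f" and sS: "square_integrable (schrodinger n c f)"
    using f by (auto intro: test_function_square_integrable schrodinger_square_integrable)
  have sg: "square_integrable ?g"
    by (intro square_integrable_diff sS square_integrable_scale sf)
  have D: "abs_l2 f \<in> D" and "H (abs_l2 f) = abs_l2 (schrodinger n c f)"
    using H f by (auto simp: closed_schrodinger_extension_def)
  then have eq: "shifted H w (abs_l2 f) = abs_l2 ?g"
    by (simp add: shifted_def diff_scaleC_abs_l2[OF sf sS])
  have g0: "?g x = 0" if "\<bar>x - y\<bar> > l" for x
  proof -
    have "closure (support_on UNIV f) \<subseteq> {x. \<bar>x - y\<bar> \<le> l}"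
    proof (rule closure_minimal)
      show "support_on UNIV f \<subseteq> {x. \<bar>x - y\<bar> \<le> l}"
        using supp by (force simp: support_on_def)
      show "closed {x. \<bar>x - y\<bar> \<le> l}"
        by (intro closed_Collect_le continuous_intros)
    qed
    then have "x \<notin> closure (support_on UNIV f)"
      using that by auto
    then show ?thesis
      using test_function_support[of x f 0] test_function_support[of x f 2]
      by (simp add: schrodinger_def)
  qed
  have B: "norm (shifted H w (abs_l2 f)) \<le> sqrt (2 * l) * M"
    unfolding eq using g0 small M l by (intro norm_abs_l2_le[OF sg]) auto
  have "sqrt (2 * l') * M' \<le> norm (abs_l2 f)"
    using l M large by (intro norm_abs_l2_ge[OF sf]) auto
  then have "sqrt (2 * l') * M' / (sqrt (2 * l) * M) \<le> norm (abs_l2 f) / (sqrt (2 * l) * M)"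
    using l M by (intro divide_right_mono) auto
  also have "ereal \<dots> \<le> resolvent_norm D H w"
    using l M by (intro resolvent_norm_ge[OF D B]) auto
  finally show ?thesis by simp
qed

section \<open>Smooth cutoffs of Gaussian wave packets\<close>

lemma power_le_fact_mult_exp:
  fixes x :: real
  assumes "x \<ge> 0"
  shows "x ^ k \<le> fact k * exp x"
proof -
  have "x ^ k / fact k = (\<Sum>i\<in>{k}. x ^ i /\<^sub>R fact i)"
    by (simp add: field_simps)
  also have "\<dots> \<le> (\<Sum>i. x ^ i /\<^sub>R fact i)"
    using assms by (intro sum_le_suminf summable_exp_generic) auto
  also have "\<dots> = exp x" by (simp add: exp_def)
  finally show ?thesis by (simp add: field_simps)
qed

text \<open>The family is closed under differentiation up to linear combinations (\<open>DERIV_flat\<close>),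
  including at the origin; for \<open>k = 0\<close> it is the standard smooth function that is flat at \<open>0\<close>.\<close>

definition flat :: "nat \<Rightarrow> real \<Rightarrow> real" where
  "flat k y = (if y > 0 then exp (- 1 / y) / y ^ k else 0)"

lemma flat_nonneg: "flat k y \<ge> 0"
  by (simp add: flat_def)

text \<open>With \<open>u = 1 / y\<close> this is \<open>u ^ k \<le> k! exp u\<close>, one term of the exponential series.\<close>

lemma flat_le_fact: "flat k y \<le> fact k"
proof (cases "y > 0")
  case True
  then show ?thesis
    using power_le_fact_mult_exp[of "1 / y" k]
    by (simp add: flat_def exp_minus field_simps power_divide)
qed (simp add: flat_def)

lemma flat_Suc: "y * flat (Suc k) y = flat k y"
  by (simp add: flat_def)

lemma DERIV_flat: "(flat k has_real_derivative flat (k + 2) y - k * flat (k + 1) y) (at y)"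
proof (cases y "0 :: real" rule: linorder_cases)
  case less
  have "(flat k has_real_derivative 0) (at y)"
    by (rule has_field_derivative_transform_within_open[where f="\<lambda>_. 0" and S="{..<0}"])
      (use less in \<open>auto simp: flat_def\<close>)
  then show ?thesis using less by (simp add: flat_def)
next
  case equal
  have "((\<lambda>h. flat k h / h) \<longlongrightarrow> 0) (at 0)"
  proof (rule Lim_null_comparison)
    show "\<forall>\<^sub>F h in at 0. norm (flat k h / h) \<le> fact (k + 2) * \<bar>h\<bar>"
    proof (rule always_eventually, rule)
      fix h :: real
      have "flat k h / h = h * flat (k + 2) h"
        using flat_Suc[of h k] flat_Suc[of h "Suc k"] by (cases "h = 0") (auto simp: field_simps)
      then show "norm (flat k h / h) \<le> fact (k + 2) * \<bar>h\<bar>"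
        using flat_le_fact[of "k + 2" h] flat_nonneg[of "k + 2" h]
        by (simp only: real_norm_def abs_mult abs_of_nonneg mult.commute[of _ "\<bar>h\<bar>"] mult_left_mono abs_ge_zero)
    qed
    show "((\<lambda>h. fact (k + 2) * \<bar>h\<bar>) \<longlongrightarrow> 0) (at (0::real))"
      by (auto intro!: tendsto_eq_intros)
  qed
  then show ?thesis
    using equal by (simp add: DERIV_def flat_def)
next
  case greater
  have "((\<lambda>y. exp (- 1 / y) / y ^ k) has_real_derivative flat (k + 2) y - k * flat (k + 1) y) (at y)"
    using greater
  proof (cases k)
    case (Suc i)
    have "((\<lambda>y. exp (- 1 / y) / y ^ k) has_real_derivative
        (exp (- 1 / y) * (1 / y\<^sup>2) * y ^ k - exp (- 1 / y) * (k * y ^ i)) / (y ^ k * y ^ k)) (at y)"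
    proof -
      have "real i * y ^ (i - Suc 0) * y = real i * y ^ i" by (cases i) auto
      then show ?thesis
        using greater
        by (auto intro!: derivative_eq_intros simp: Suc power2_eq_square algebra_simps)
    qed
    also have "(exp (- 1 / y) * (1 / y\<^sup>2) * y ^ k - exp (- 1 / y) * (k * y ^ i)) / (y ^ k * y ^ k)
        = flat (k + 2) y - k * flat (k + 1) y"
      using greater by (simp add: flat_def Suc field_simps power2_eq_square)
    finally show ?thesis .
  qed (use greater in \<open>auto intro!: derivative_eq_intros simp: flat_def field_simps power2_eq_square\<close>)
  then show ?thesis
    by (rule has_field_derivative_transform_within_open[where S="{0<..}"])
      (use greater in \<open>auto simp: flat_def\<close>)
qed

text \<open>Products of a cutoff at \<open>\<bar>t\<bar> = 1 / sqrt \<delta>\<close>, a polynomial and an exponential. Fixing \<open>\<delta>\<close> and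
  \<open>q\<close> and letting \<open>k\<close> and \<open>p\<close> vary gives a set whose additive span is stable under
  differentiation, which is the reason for admitting all powers \<open>k\<close>.\<close>

definition cutoff_gauss ::
    "real \<Rightarrow> complex poly \<Rightarrow> nat \<Rightarrow> complex poly \<Rightarrow> real \<Rightarrow> complex" where
  "cutoff_gauss \<delta> q k p t =
     of_real (flat k (1 - \<delta> * t\<^sup>2)) * poly p (of_real t) * exp (poly q (of_real t))"

lemma has_vector_derivative_poly_of_real:
  "((\<lambda>t. poly p (of_real t :: complex)) has_vector_derivative poly (pderiv p) (of_real t)) (at t within S)"
  by (rule has_vector_derivative_real_field) (rule poly_DERIV)

lemma cutoff_gauss_has_derivative:
  "(cutoff_gauss \<delta> q k p has_vector_derivative
      cutoff_gauss \<delta> q (k + 2) ([:0, - 2 * of_real \<delta>:] * p) t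
      + cutoff_gauss \<delta> q (k + 1) ([:0, 2 * of_nat k * of_real \<delta>:] * p) t
      + cutoff_gauss \<delta> q k (pderiv p + pderiv q * p) t) (at t)"
proof -
  have 1: "((\<lambda>t. flat k (1 - \<delta> * t\<^sup>2)) has_real_derivative
      (flat (k + 2) (1 - \<delta> * t\<^sup>2) - k * flat (k + 1) (1 - \<delta> * t\<^sup>2)) * (- 2 * \<delta> * t)) (at t)"
    by (rule DERIV_chain2[OF DERIV_flat]) (auto intro!: derivative_eq_intros)
  have 2: "((\<lambda>t. exp (poly q (of_real t))) has_vector_derivative
      exp (poly q (of_real t)) * poly (pderiv q) (of_real t)) (at t)"
    by (rule has_vector_derivative_real_field) (auto intro!: derivative_eq_intros poly_DERIV)
  show ?thesis
    unfolding cutoff_gauss_def[abs_def]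
    by (rule has_vector_derivative_eq_rhs,
      (rule has_vector_derivative_mult has_vector_derivative_of_real[OF 1] 2
        has_vector_derivative_poly_of_real)+)
      (simp add: algebra_simps)
qed

inductive cutoff_gauss_span :: "real \<Rightarrow> complex poly \<Rightarrow> (real \<Rightarrow> complex) \<Rightarrow> bool" for \<delta> q where
  base: "cutoff_gauss_span \<delta> q (cutoff_gauss \<delta> q k p)"
| add: "cutoff_gauss_span \<delta> q f \<Longrightarrow> cutoff_gauss_span \<delta> q g \<Longrightarrow> cutoff_gauss_span \<delta> q (\<lambda>t. f t + g t)"

text \<open>Differentiability together with stability of the class under derivatives yields smoothness
  to all orders without a Leibniz rule for higher derivatives.\<close>

lemma cutoff_gauss_span_derivative:
  assumes "cutoff_gauss_span \<delta> q f"
  shows "\<exists>f'. cutoff_gauss_span \<delta> q f' \<and> (\<forall>t. (f has_vector_derivative f' t) (at t))"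
  using assms
proof induction
  case (base k p)
  show ?case
    by (rule exI, rule conjI, rule cutoff_gauss_span.add, rule cutoff_gauss_span.add)
      (blast intro: cutoff_gauss_span.base cutoff_gauss_has_derivative)+
next
  case (add f g)
  then obtain f' g' where "cutoff_gauss_span \<delta> q f'" "cutoff_gauss_span \<delta> q g'"
    "\<forall>t. (f has_vector_derivative f' t) (at t)" "\<forall>t. (g has_vector_derivative g' t) (at t)"
    by blast
  then show ?case
    by (intro exI[of _ "\<lambda>t. f' t + g' t"]) (auto intro: cutoff_gauss_span.add has_vector_derivative_add)
qed

lemma vderiv_eqI: "(\<And>t. (f has_vector_derivative f' t) (at t)) \<Longrightarrow> vderiv f = f'"
  by (simp add: vderiv_def fun_eq_iff vector_derivative_at)

lemma cutoff_gauss_span_vderiv: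
  "cutoff_gauss_span \<delta> q f \<Longrightarrow> cutoff_gauss_span \<delta> q ((vderiv ^^ k) f)"
proof (induction k)
  case (Suc k)
  then obtain f' where "cutoff_gauss_span \<delta> q f'"
    and "\<And>t. ((vderiv ^^ k) f has_vector_derivative f' t) (at t)"
    using cutoff_gauss_span_derivative by blast
  then show ?case using vderiv_eqI[of "(vderiv ^^ k) f" f'] by simp
qed simp

lemma compact_closure_support:
  fixes f :: "real \<Rightarrow> complex"
  assumes "\<And>x. \<bar>x - y\<bar> > l \<Longrightarrow> f x = 0"
  shows "compact (closure (support_on UNIV f))"
proof -
  have "support_on UNIV f \<subseteq> cball y l"
    using assms by (force simp: support_on_def dist_real_def abs_minus_commute)
  then show ?thesis
    using bounded_subset[OF bounded_cball] by (simp add: compact_closure)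
qed

lemma cutoff_gauss_eq_0:
  assumes "\<rho> > 0" "\<bar>t\<bar> > 1 / \<rho>"
  shows "cutoff_gauss (\<rho>\<^sup>2) q k p t = 0"
proof -
  have "1 < \<rho> * \<bar>t\<bar>" using assms by (simp add: field_simps)
  then have "1 < (\<rho> * \<bar>t\<bar>)\<^sup>2" by (simp add: one_less_power)
  then have "1 < \<rho>\<^sup>2 * t\<^sup>2" by (simp add: power_mult_distrib)
  then show ?thesis by (simp add: cutoff_gauss_def flat_def)
qed

lemma test_function_cutoff_gauss:
  assumes "\<rho> > 0"
  shows "test_function (cutoff_gauss (\<rho>\<^sup>2) q k p)"
  unfolding test_function_def
proof (intro conjI allI)
  fix j x
  have "cutoff_gauss_span (\<rho>\<^sup>2) q ((vderiv ^^ j) (cutoff_gauss (\<rho>\<^sup>2) q k p))"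
    by (intro cutoff_gauss_span_vderiv cutoff_gauss_span.base)
  from cutoff_gauss_span_derivative[OF this]
  show "(vderiv ^^ j) (cutoff_gauss (\<rho>\<^sup>2) q k p) differentiable at x"
    by (auto simp: differentiable_def has_vector_derivative_def)
  show "compact (closure (support_on UNIV (cutoff_gauss (\<rho>\<^sup>2) q k p)))"
    using assms by (intro compact_closure_support[where y=0 and l="1 / \<rho>"] cutoff_gauss_eq_0) simp_all
qed

lemma vderiv_affine:
  assumes smooth: "\<And>k x. (vderiv ^^ k) f differentiable at x"
  shows "((\<lambda>x. of_real (\<tau> ^ k) * (vderiv ^^ k) f (\<tau> * (x - y))) has_vector_derivative
      of_real (\<tau> ^ Suc k) * (vderiv ^^ Suc k) f (\<tau> * (x - y))) (at x)"
    and "(vderiv ^^ k) (\<lambda>x. f (\<tau> * (x - y))) = (\<lambda>x. of_real (\<tau> ^ k) * (vderiv ^^ k) f (\<tau> * (x - y)))"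
proof -
  have *: "((\<lambda>x. of_real (\<tau> ^ k) * (vderiv ^^ k) f (\<tau> * (x - y))) has_vector_derivative
      of_real (\<tau> ^ Suc k) * (vderiv ^^ Suc k) f (\<tau> * (x - y))) (at x)" for k x
  proof -
    have "((vderiv ^^ k) f has_vector_derivative (vderiv ^^ Suc k) f (\<tau> * (x - y))) (at (\<tau> * (x - y)))"
      using smooth[of k] by (simp add: vderiv_def vector_derivative_works)
    moreover have "((\<lambda>x. \<tau> * (x - y)) has_vector_derivative \<tau>) (at x)"
      by (auto intro!: derivative_eq_intros simp: has_real_derivative_iff_has_vector_derivative[symmetric])
    ultimately have "((\<lambda>x. (vderiv ^^ k) f (\<tau> * (x - y))) has_vector_derivative
        \<tau> *\<^sub>R (vderiv ^^ Suc k) f (\<tau> * (x - y))) (at x)"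
      using vector_diff_chain_at[of "\<lambda>x. \<tau> * (x - y)" \<tau> x "(vderiv ^^ k) f"] by (simp add: o_def)
    from has_vector_derivative_mult_right[OF this, of "of_real (\<tau> ^ k)"]
    show ?thesis by (simp add: scaleR_conv_of_real mult_ac)
  qed
  show "((\<lambda>x. of_real (\<tau> ^ k) * (vderiv ^^ k) f (\<tau> * (x - y))) has_vector_derivative
      of_real (\<tau> ^ Suc k) * (vderiv ^^ Suc k) f (\<tau> * (x - y))) (at x)" by (rule *)
  show "(vderiv ^^ k) (\<lambda>x. f (\<tau> * (x - y))) = (\<lambda>x. of_real (\<tau> ^ k) * (vderiv ^^ k) f (\<tau> * (x - y)))"
  proof (induction k)
    case (Suc k)
    then show ?case using vderiv_eqI[OF *, of k] by simp
  qed simp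
qed

lemma test_function_affine:
  assumes smooth: "\<And>k x. (vderiv ^^ k) f differentiable at x"
    and supp: "\<And>t. \<bar>t\<bar> > l \<Longrightarrow> f t = 0" and "\<tau> > 0"
  shows "test_function (\<lambda>x. f (\<tau> * (x - y)))"
  unfolding test_function_def
proof (intro conjI allI)
  fix k x
  show "(vderiv ^^ k) (\<lambda>x. f (\<tau> * (x - y))) differentiable at x"
    unfolding vderiv_affine(2)[OF smooth]
    using vderiv_affine(1)[OF smooth, of \<tau> k] by (auto simp: differentiable_def has_vector_derivative_def)
  show "compact (closure (support_on UNIV (\<lambda>x. f (\<tau> * (x - y)))))"
    using \<open>\<tau> > 0\<close> by (intro compact_closure_support[where y=y and l="l / \<tau>"] supp)
      (simp add: abs_mult pos_divide_less_eq mult.commute)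
qed

section \<open>Convergent families of polynomials\<close>

text \<open>Coefficientwise convergence with a common degree bound. The bound on the degree makes
  evaluation, products and antiderivatives continuous, and it turns coefficient bounds into
  uniform bounds against a Gaussian.\<close>

definition poly_tendsto :: "('a \<Rightarrow> complex poly) \<Rightarrow> complex poly \<Rightarrow> 'a filter \<Rightarrow> bool" where
  "poly_tendsto P L F \<longleftrightarrow>
     (\<exists>d. \<forall>r. degree (P r) \<le> d) \<and> (\<forall>i. ((\<lambda>r. coeff (P r) i) \<longlongrightarrow> coeff L i) F)"

lemma poly_tendstoI:
  "(\<And>r. degree (P r) \<le> d) \<Longrightarrow> (\<And>i. ((\<lambda>r. coeff (P r) i) \<longlongrightarrow> coeff L i) F) \<Longrightarrow> poly_tendsto P L F"
  by (auto simp: poly_tendsto_def)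

lemma poly_tendstoE:
  assumes "poly_tendsto P L F"
  obtains d where "\<And>r. degree (P r) \<le> d" "\<And>i. ((\<lambda>r. coeff (P r) i) \<longlongrightarrow> coeff L i) F"
  using assms by (auto simp: poly_tendsto_def)

lemma poly_tendsto_coeff: "poly_tendsto P L F \<Longrightarrow> ((\<lambda>r. coeff (P r) i) \<longlongrightarrow> coeff L i) F"
  by (simp add: poly_tendsto_def)

lemma poly_tendsto_const [simp, intro]: "poly_tendsto (\<lambda>r. p) p F"
  by (auto simp: poly_tendsto_def)

lemma poly_tendsto_pCons:
  assumes "(a \<longlongrightarrow> l) F" "poly_tendsto P L F"
  shows "poly_tendsto (\<lambda>r. pCons (a r) (P r)) (pCons l L) F"
  using assms(2)
proof (rule poly_tendstoE)
  fix d assume *: "\<And>r. degree (P r) \<le> d" "\<And>i. ((\<lambda>r. coeff (P r) i) \<longlongrightarrow> coeff L i) F"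
  show ?thesis
  proof (rule poly_tendstoI)
    show "degree (pCons (a r) (P r)) \<le> Suc d" for r
      using degree_pCons_le[of "a r" "P r"] *(1)[of r] by linarith
    show "((\<lambda>r. coeff (pCons (a r) (P r)) i) \<longlongrightarrow> coeff (pCons l L) i) F" for i
      using * assms(1) by (cases i) auto
  qed
qed

lemma poly_tendsto_add:
  assumes "poly_tendsto P L F" "poly_tendsto P' L' F"
  shows "poly_tendsto (\<lambda>r. P r + P' r) (L + L') F"
proof -
  obtain d d' where "\<And>r. degree (P r) \<le> d" "\<And>r. degree (P' r) \<le> d'"
    using assms by (auto simp: poly_tendsto_def)
  then have "degree (P r + P' r) \<le> max d d'" for r
    by (meson degree_add_le max.coboundedI1 max.coboundedI2)
  then show ?thesis
    using assms by (intro poly_tendstoI) (auto intro!: tendsto_add poly_tendsto_coeff)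
qed

lemma poly_tendsto_mult:
  assumes "poly_tendsto P L F" "poly_tendsto P' L' F"
  shows "poly_tendsto (\<lambda>r. P r * P' r) (L * L') F"
proof -
  obtain d d' where d: "\<And>r. degree (P r) \<le> d" "\<And>r. degree (P' r) \<le> d'"
    using assms by (auto simp: poly_tendsto_def)
  have "degree (P r * P' r) \<le> d + d'" for r
    using degree_mult_le[of "P r" "P' r"] d[of r] by linarith
  then show ?thesis
    using assms by (intro poly_tendstoI)
      (auto simp: coeff_mult intro!: tendsto_sum tendsto_mult poly_tendsto_coeff)
qed

lemma poly_tendsto_smult:
  assumes "(a \<longlongrightarrow> l) F" "poly_tendsto P L F"
  shows "poly_tendsto (\<lambda>r. smult (a r) (P r)) (smult l L) F"
  using poly_tendsto_mult[OF poly_tendsto_pCons[OF assms(1) poly_tendsto_const[of 0]] assms(2)]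
  by simp

lemma poly_tendsto_minus:
  assumes "poly_tendsto P L F"
  shows "poly_tendsto (\<lambda>r. - P r) (- L) F"
  using poly_tendsto_mult[OF poly_tendsto_const[of "-1"] assms] by simp

lemma poly_tendsto_diff:
  assumes "poly_tendsto P L F" "poly_tendsto P' L' F"
  shows "poly_tendsto (\<lambda>r. P r - P' r) (L - L') F"
  using poly_tendsto_add[OF assms(1) poly_tendsto_minus[OF assms(2)]] by simp

lemma poly_tendsto_power:
  "poly_tendsto P L F \<Longrightarrow> poly_tendsto (\<lambda>r. P r ^ k) (L ^ k) F"
  by (induction k) (auto intro!: poly_tendsto_mult)

lemma poly_tendsto_sum:
  "(\<And>i. i \<in> I \<Longrightarrow> poly_tendsto (P i) (L i) F) \<Longrightarrow>
    poly_tendsto (\<lambda>r. \<Sum>i\<in>I. P i r) (\<Sum>i\<in>I. L i) F"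
  by (induction I rule: infinite_finite_induct) (auto intro!: poly_tendsto_add)

lemma poly_tendsto_pderiv:
  assumes "poly_tendsto P L F"
  shows "poly_tendsto (\<lambda>r. pderiv (P r)) (pderiv L) F"
  using assms
proof (rule poly_tendstoE)
  fix d assume *: "\<And>r. degree (P r) \<le> d" "\<And>i. ((\<lambda>r. coeff (P r) i) \<longlongrightarrow> coeff L i) F"
  show ?thesis
    by (rule poly_tendstoI[of _ d])
      (auto simp: coeff_pderiv degree_pderiv intro!: tendsto_mult * intro: order.trans[OF diff_le_self])
qed

lemma poly_eq_sum_coeff:
  fixes p :: "complex poly"
  assumes "degree p \<le> d"
  shows "poly p x = (\<Sum>i\<le>d. coeff p i * x ^ i)"
  by (subst poly_as_sum_of_monoms'[OF assms, symmetric]) (simp add: poly_sum poly_monom)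

lemma poly_tendsto_poly:
  assumes "poly_tendsto P L F" "(x \<longlongrightarrow> y) F"
  shows "((\<lambda>r. poly (P r) (x r)) \<longlongrightarrow> poly L y) F"
  using assms(1)
proof (rule poly_tendstoE)
  fix d assume *: "\<And>r. degree (P r) \<le> d" "\<And>i. ((\<lambda>r. coeff (P r) i) \<longlongrightarrow> coeff L i) F"
  have eq: "poly p t = (\<Sum>i\<le>d + degree L. coeff p i * t ^ i)" if "degree p \<le> d + degree L" for p and t :: complex
    using that by (rule poly_eq_sum_coeff)
  have "((\<lambda>r. \<Sum>i\<le>d + degree L. coeff (P r) i * x r ^ i) \<longlongrightarrow>
      (\<Sum>i\<le>d + degree L. coeff L i * y ^ i)) F"
    using * assms(2) by (intro tendsto_intros)
  moreover have "degree (P r) \<le> d + degree L" for r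
    using *(1)[of r] by simp
  ultimately show ?thesis
    using eq by simp
qed

definition prim :: "complex poly \<Rightarrow> complex poly" where
  "prim p = (\<Sum>i\<le>degree p. monom (coeff p i / of_nat (Suc i)) (Suc i))"

lemma coeff_prim: "coeff (prim p) j = (case j of 0 \<Rightarrow> 0 | Suc i \<Rightarrow> coeff p i / of_nat (Suc i))"
proof (cases j)
  case 0
  then show ?thesis by (simp add: prim_def coeff_sum)
next
  case (Suc i)
  then show ?thesis
    by (simp add: prim_def coeff_sum sum.delta if_distrib cong: if_cong)
      (auto simp: coeff_eq_0)
qed

lemma pderiv_prim [simp]: "pderiv (prim p) = p"
  by (rule poly_eqI) (simp add: coeff_pderiv coeff_prim del: of_nat_Suc)

lemma poly_tendsto_prim:
  assumes "poly_tendsto P L F"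
  shows "poly_tendsto (\<lambda>r. prim (P r)) (prim L) F"
  using assms
proof (rule poly_tendstoE)
  fix d assume *: "\<And>r. degree (P r) \<le> d" "\<And>i. ((\<lambda>r. coeff (P r) i) \<longlongrightarrow> coeff L i) F"
  show ?thesis
  proof (rule poly_tendstoI)
    show "degree (prim (P r)) \<le> Suc d" for r
      using *(1)[of r] by (intro degree_le) (auto simp: coeff_prim coeff_eq_0 split: nat.split)
    show "((\<lambda>r. coeff (prim (P r)) i) \<longlongrightarrow> coeff (prim L) i) F" for i
      using *(2) by (cases i) (auto simp: coeff_prim intro!: tendsto_divide simp del: of_nat_Suc)
  qed
qed

text \<open>From \<open>\<bar>t\<bar> ^ i \<le> i! exp \<bar>t\<bar>\<close> and completing the square in \<open>\<bar>t\<bar> - \<beta> t\<^sup>2\<close>.\<close>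

lemma power_mult_gauss_le:
  fixes t \<beta> :: real
  assumes "\<beta> > 0"
  shows "\<bar>t\<bar> ^ i * exp (- \<beta> * t\<^sup>2) \<le> fact i * exp (1 / (4 * \<beta>))"
proof -
  have "\<bar>t\<bar> ^ i * exp (- \<beta> * t\<^sup>2) \<le> fact i * exp \<bar>t\<bar> * exp (- \<beta> * t\<^sup>2)"
    by (intro mult_right_mono power_le_fact_mult_exp) auto
  also have "\<dots> = fact i * exp (\<bar>t\<bar> - \<beta> * t\<^sup>2)"
    by (simp add: exp_diff exp_minus field_simps)
  also have "\<bar>t\<bar> - \<beta> * t\<^sup>2 \<le> 1 / (4 * \<beta>)"
  proof -
    have "0 \<le> (2 * \<beta> * \<bar>t\<bar> - 1)\<^sup>2" by simp
    also have "\<dots> = 4 * \<beta>\<^sup>2 * t\<^sup>2 - 4 * \<beta> * \<bar>t\<bar> + 1"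
      by (simp add: power2_diff power_mult_distrib)
    finally show ?thesis
      using assms by (simp add: field_simps power2_eq_square)
  qed
  finally show ?thesis by simp
qed

lemma poly_tendsto_gauss_bound:
  assumes "poly_tendsto P L F" "\<beta> > 0"
  shows "\<exists>C>0. \<forall>\<^sub>F r in F. \<forall>t::real. cmod (poly (P r) (of_real t)) * exp (- \<beta> * t\<^sup>2) \<le> C"
  using assms(1)
proof (rule poly_tendstoE)
  fix d assume *: "\<And>r. degree (P r) \<le> d" "\<And>i. ((\<lambda>r. coeff (P r) i) \<longlongrightarrow> coeff L i) F"
  define C where "C = (\<Sum>i\<le>d. (cmod (coeff L i) + 1) * (fact i * exp (1 / (4 * \<beta>))))"
  have "\<forall>\<^sub>F r in F. \<forall>i\<in>{..d}. cmod (coeff (P r) i) < cmod (coeff L i) + 1"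
    by (intro eventually_ball_finite ballI order_tendstoD(2)[OF tendsto_norm[OF *(2)]]) auto
  then have "\<forall>\<^sub>F r in F. \<forall>t::real. cmod (poly (P r) (of_real t)) * exp (- \<beta> * t\<^sup>2) \<le> C"
  proof eventually_elim
    case (elim r)
    show ?case
    proof
      fix t :: real
      have "cmod (poly (P r) (of_real t)) \<le> (\<Sum>i\<le>d. cmod (coeff (P r) i) * \<bar>t\<bar> ^ i)"
        unfolding poly_eq_sum_coeff[OF *(1)]
        by (rule order.trans[OF norm_sum]) (simp add: norm_mult norm_power)
      also have "\<dots> * exp (- \<beta> * t\<^sup>2) =
          (\<Sum>i\<le>d. cmod (coeff (P r) i) * (\<bar>t\<bar> ^ i * exp (- \<beta> * t\<^sup>2)))"
        by (simp add: sum_distrib_right mult.assoc)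
      also have "\<dots> \<le> C"
        unfolding C_def using elim
        by (intro sum_mono mult_mono power_mult_gauss_le assms(2)) (auto intro: less_imp_le)
      finally show "cmod (poly (P r) (of_real t)) * exp (- \<beta> * t\<^sup>2) \<le> C"
        by (simp add: mult_right_mono)
    qed
  qed
  moreover have "C > 0"
    unfolding C_def by (intro sum_pos) (auto intro!: mult_pos_pos add_nonneg_pos)
  ultimately show ?thesis by blast
qed

section \<open>Transport equations for the amplitude\<close>

lemma vderiv_vderiv_cutoff_gauss:
  defines "X \<equiv> \<lambda>\<delta>. [:0, - 2 * complex_of_real \<delta>:]" and "D \<equiv> \<lambda>q p. pderiv p + pderiv q * p"
  shows "(vderiv ^^ 2) (cutoff_gauss \<delta> q 0 p) t =
    cutoff_gauss \<delta> q 4 (X \<delta> * (X \<delta> * p)) t + cutoff_gauss \<delta> q 3 (smult (- 2) (X \<delta> * (X \<delta> * p))) t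
    + cutoff_gauss \<delta> q 2 ([:- 2 * of_real \<delta>:] * p + 2 * (X \<delta> * D q p)) t + cutoff_gauss \<delta> q 0 (D q (D q p)) t"
proof -
  have 0: "cutoff_gauss \<delta> q k 0 t = 0" for k t
    by (simp add: cutoff_gauss_def)
  have "vderiv (cutoff_gauss \<delta> q 0 p) = (\<lambda>t. cutoff_gauss \<delta> q 2 (X \<delta> * p) t + cutoff_gauss \<delta> q 0 (D q p) t)"
    by (rule vderiv_eqI, rule has_vector_derivative_eq_rhs, rule cutoff_gauss_has_derivative)
      (simp add: 0 X_def D_def numeral_2_eq_2)
  moreover have "vderiv (\<lambda>t. cutoff_gauss \<delta> q 2 (X \<delta> * p) t + cutoff_gauss \<delta> q 0 (D q p) t) =
    (\<lambda>t. cutoff_gauss \<delta> q 4 (X \<delta> * (X \<delta> * p)) t + cutoff_gauss \<delta> q 3 (smult (- 2) (X \<delta> * (X \<delta> * p))) t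
    + cutoff_gauss \<delta> q 2 ([:- 2 * of_real \<delta>:] * p + 2 * (X \<delta> * D q p)) t + cutoff_gauss \<delta> q 0 (D q (D q p)) t)"
    by (rule vderiv_eqI, rule has_vector_derivative_eq_rhs, rule has_vector_derivative_add,
      (rule cutoff_gauss_has_derivative)+)
      (simp add: cutoff_gauss_def X_def D_def pderiv_mult pderiv_pCons pderiv_smult pderiv_minus
        numeral_eq_Suc algebra_simps)
  ultimately show ?thesis by (simp add: numeral_2_eq_2)
qed

text \<open>The part of the conjugated operator that carries the extra factor \<open>\<epsilon>\<close>; \<open>Q\<close> is the Taylor
  remainder of the potential of order at least two, divided by \<open>\<epsilon>\<^sup>2\<close> (see \<open>conjugated_operator\<close>).\<close>

definition transport_op :: "complex \<Rightarrow> complex poly \<Rightarrow> complex poly \<Rightarrow> complex poly" where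
  "transport_op b Q p = - pderiv (pderiv p) + [:0, 2 * b:] * pderiv p + ([:b, 0, - b\<^sup>2:] + Q) * p"

text \<open>One solves \<open>\<mu> p' = M p\<^sub>0\<close> with \<open>p 0 = 0\<close>, where \<open>M\<close> is the transport operator.\<close>

definition transport_step :: "complex \<Rightarrow> complex \<Rightarrow> complex poly \<Rightarrow> complex poly \<Rightarrow> complex poly" where
  "transport_step \<mu> b Q p = smult (1 / \<mu>) (prim (transport_op b Q p))"

text \<open>Picard iterates of \<open>\<mu> p' = \<epsilon> M p\<close>, \<open>p 0 = 1\<close>. They are never required to converge; finitely
  many steps give any order in \<open>\<epsilon>\<close>.\<close>

primrec amplitude :: "complex \<Rightarrow> complex \<Rightarrow> complex \<Rightarrow> complex poly \<Rightarrow> nat \<Rightarrow> complex poly" where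
  "amplitude \<epsilon> \<mu> b Q 0 = 1"
| "amplitude \<epsilon> \<mu> b Q (Suc N) = 1 + smult \<epsilon> (transport_step \<mu> b Q (amplitude \<epsilon> \<mu> b Q N))"

lemma prim_add: "prim (p + q) = prim p + prim q"
  by (rule poly_eqI) (auto simp: coeff_prim add_divide_distrib split: nat.split)

lemma prim_smult: "prim (smult a p) = smult a (prim p)"
  by (rule poly_eqI) (auto simp: coeff_prim split: nat.split)

lemma transport_op_add: "transport_op b Q (p + q) = transport_op b Q p + transport_op b Q q"
  by (simp only: transport_op_def pderiv_add minus_add_distrib ring_distribs add_ac)

lemma transport_op_smult: "transport_op b Q (smult a p) = smult a (transport_op b Q p)"
  by (simp only: transport_op_def pderiv_smult smult_add_right mult_smult_right smult_minus_right)

lemma transport_step_add: "transport_step \<mu> b Q (p + q) = transport_step \<mu> b Q p + transport_step \<mu> b Q q"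
  by (simp add: transport_step_def transport_op_add prim_add smult_add_right)

lemma transport_step_smult: "transport_step \<mu> b Q (smult a p) = smult a (transport_step \<mu> b Q p)"
  by (simp add: transport_step_def transport_op_smult prim_smult mult.commute)

lemma amplitude_Suc:
  "amplitude \<epsilon> \<mu> b Q (Suc N) = amplitude \<epsilon> \<mu> b Q N + smult (\<epsilon> ^ Suc N) ((transport_step \<mu> b Q ^^ Suc N) 1)"
proof (induction N)
  case (Suc N)
  have "amplitude \<epsilon> \<mu> b Q (Suc (Suc N)) = 1 + smult \<epsilon> (transport_step \<mu> b Q (amplitude \<epsilon> \<mu> b Q (Suc N)))"
    by simp
  also have "\<dots> = 1 + smult \<epsilon> (transport_step \<mu> b Q (amplitude \<epsilon> \<mu> b Q N))
      + smult (\<epsilon> ^ Suc (Suc N)) ((transport_step \<mu> b Q ^^ Suc (Suc N)) 1)"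
    unfolding Suc.IH by (simp add: transport_step_add transport_step_smult smult_add_right)
  finally show ?case by simp
qed (simp add: transport_step_def)

text \<open>Consecutive iterates differ by \<open>\<epsilon> ^ N T ^ N 1\<close>, where \<open>T\<close> is the linear transport step, so
  the defect in the equation is the image of this difference under \<open>\<epsilon> M\<close>.\<close>

lemma transport_equation_amplitude:
  assumes "\<mu> \<noteq> 0"
  shows "smult \<epsilon> (transport_op b Q (amplitude \<epsilon> \<mu> b Q N)) - smult \<mu> (pderiv (amplitude \<epsilon> \<mu> b Q N)) =
    smult (\<epsilon> ^ Suc N) (transport_op b Q ((transport_step \<mu> b Q ^^ N) 1))"
proof (cases N)
  case (Suc M)
  have "smult \<mu> (pderiv (amplitude \<epsilon> \<mu> b Q N)) = smult \<epsilon> (transport_op b Q (amplitude \<epsilon> \<mu> b Q M))"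
    using assms by (simp add: Suc transport_step_def pderiv_add pderiv_smult)
  moreover have "transport_op b Q (amplitude \<epsilon> \<mu> b Q N) = transport_op b Q (amplitude \<epsilon> \<mu> b Q M)
      + smult (\<epsilon> ^ N) (transport_op b Q ((transport_step \<mu> b Q ^^ N) 1))"
    unfolding Suc amplitude_Suc by (simp only: transport_op_add transport_op_smult)
  ultimately show ?thesis
    by (simp add: smult_add_right)
qed simp

lemma norm_exp_phase:
  fixes \<epsilon> \<eta> t :: real
  shows "cmod (exp (poly [:0, \<i> * of_real \<eta> / of_real \<epsilon>, - b / 2:] (of_real t))) = exp (- (Re b / 2) * t\<^sup>2)"
proof -
  have "complex_of_real t * (\<i> * of_real \<eta> / of_real \<epsilon>) = \<i> * of_real (t * \<eta> / \<epsilon>)"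
    by simp
  then have "Re (poly [:0, \<i> * of_real \<eta> / of_real \<epsilon>, - b / 2:] (of_real t)) = - (Re b / 2) * t\<^sup>2"
    by (simp add: power2_eq_square algebra_simps)
  then show ?thesis by (simp only: norm_exp_eq_Re)
qed

text \<open>The left side is \<open>exp (- q) (- \<epsilon>\<^sup>2 d\<^sup>2/dt\<^sup>2 + W (\<epsilon> t)) exp q\<close> acting on \<open>p\<close>, as \<open>D q\<close> is the
  derivative conjugated by \<open>exp q\<close>. The phase \<open>\<i> \<eta> t / \<epsilon>\<close> cancels \<open>W 0 = - \<eta>\<^sup>2\<close>, and \<open>u = - 2 \<i> \<eta>
  b\<close> cancels the linear term of \<open>W\<close> against the Gaussian.\<close>

lemma conjugated_operator:
  fixes \<epsilon> \<eta> \<mu> b u t :: complex and p Q :: "complex poly"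
  defines "q \<equiv> [:0, \<i> * \<eta> / \<epsilon>, - b / 2:]" and "D \<equiv> \<lambda>q p. pderiv p + pderiv q * p"
  assumes "\<epsilon> \<noteq> 0" "\<mu> = 2 * \<i> * \<eta>" "u = - \<mu> * b"
  shows "- \<epsilon>\<^sup>2 * poly (D q (D q p)) t + (- \<eta>\<^sup>2 + \<epsilon> * u * t + \<epsilon>\<^sup>2 * poly Q t) * poly p t =
    \<epsilon> * poly (smult \<epsilon> (transport_op b Q p) - smult \<mu> (pderiv p)) t"
proof -
  define \<kappa> where "\<kappa> = \<i> * \<eta> / \<epsilon>"
  have \<eta>: "\<i> * \<eta> = \<epsilon> * \<kappa>" using assms(3) by (simp add: \<kappa>_def)
  have \<eta>2: "- \<eta>\<^sup>2 = (\<epsilon> * \<kappa>)\<^sup>2" by (simp flip: \<eta> add: power_mult_distrib)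
  have \<mu>: "\<mu> = 2 * \<epsilon> * \<kappa>" using assms(4) \<eta> by simp
  have q': "pderiv q = [:\<kappa>, - b:]" by (simp add: q_def \<kappa>_def pderiv_pCons)
  show ?thesis
    unfolding D_def q' \<eta>2 assms(5) \<mu>
    by (simp add: transport_op_def pderiv_add pderiv_mult pderiv_pCons pderiv_smult pderiv_minus
      power2_eq_square algebra_simps)
qed

text \<open>Where all derivatives fall on the wave packet, the transport equation gives the term with
  \<open>A\<close>. The terms with \<open>B\<close> and \<open>B'\<close> collect the derivatives of the cutoff; every such term carries
  a factor \<open>\<delta>\<close>. The factors \<open>\<epsilon>\<^sup>2\<close> stay inside \<open>B\<close> and \<open>B'\<close> since the derivative of the phase is of
  size \<open>1 / \<epsilon>\<close>, and this keeps \<open>B\<close> bounded as \<open>\<epsilon> \<rightarrow> 0\<close>.\<close>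

lemma residual_bound:
  fixes \<epsilon> \<eta> \<delta> t :: real and \<mu> b u :: complex and p Q A :: "complex poly"
  defines "\<Phi> \<equiv> cutoff_gauss \<delta> [:0, \<i> * of_real \<eta> / of_real \<epsilon>, - b / 2:] 0 p"
  assumes \<epsilon>: "\<epsilon> > 0" and \<delta>: "\<delta> \<ge> 0" and \<mu>: "\<mu> = 2 * \<i> * of_real \<eta>" "u = - \<mu> * b"
    and tr: "smult (of_real \<epsilon>) (transport_op b Q p) - smult \<mu> (pderiv p) = smult (of_real \<epsilon> ^ Suc N) A"
    and B: "B = smult (2 * of_real \<epsilon>^2) p + [:0, 4:] * (smult (of_real \<epsilon>^2) (pderiv p)
              + [:\<i> * of_real (\<eta> * \<epsilon>), - (of_real \<epsilon>^2) * b:] * p)"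
    and B': "B' = smult (of_real (4 * \<delta> * \<epsilon>^2)) ([:0, 0, 1:] * p)"
  shows "cmod (- of_real (\<epsilon>\<^sup>2) * (vderiv ^^ 2) \<Phi> t
      + (- (of_real \<eta>)\<^sup>2 + of_real \<epsilon> * u * of_real t + (of_real \<epsilon>)\<^sup>2 * poly Q (of_real t)) * \<Phi> t)
    \<le> (\<epsilon> ^ (N + 2) * cmod (poly A (of_real t)) + \<delta> * (2 * cmod (poly B (of_real t)) + 36 * cmod (poly B' (of_real t))))
      * exp (- (Re b / 2) * t\<^sup>2)"
proof -
  define q where "q = [:0, \<i> * complex_of_real \<eta> / of_real \<epsilon>, - b / 2:]"
  define D where "D = (\<lambda>q p :: complex poly. pderiv p + pderiv q * p)"
  define f where "f k = complex_of_real (flat k (1 - \<delta> * t\<^sup>2))" for k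
  define E where "E = exp (poly q (complex_of_real t))"
  define V where "V = - (of_real \<eta>)\<^sup>2 + of_real \<epsilon> * u * of_real t + (of_real \<epsilon>)\<^sup>2 * poly Q (of_real t)"
  have \<epsilon>0: "complex_of_real \<epsilon> \<noteq> 0" using \<epsilon> by simp
  have q': "pderiv q = [:\<i> * of_real \<eta> / of_real \<epsilon>, - b:]" by (simp add: q_def pderiv_pCons)
  have main: "- of_real (\<epsilon>\<^sup>2) * poly (D q (D q p)) (of_real t) + V * poly p (of_real t)
      = of_real (\<epsilon> ^ (N + 2)) * poly A (of_real t)"
    using conjugated_operator[OF \<epsilon>0 \<mu>(1) \<mu>(2), of p "of_real t" Q]
    unfolding tr D_def q_def V_def by simp
  have nE: "cmod E = exp (- (Re b / 2) * t\<^sup>2)"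
    unfolding E_def q_def by (rule norm_exp_phase)
  have "- of_real (\<epsilon>\<^sup>2) * (vderiv ^^ 2) \<Phi> t + V * \<Phi> t =
      (f 0 * (- of_real (\<epsilon>\<^sup>2) * poly (D q (D q p)) (of_real t) + V * poly p (of_real t))
       + of_real \<delta> * (f 2 * poly B (of_real t) + (2 * f 3 - f 4) * poly B' (of_real t))) * E"
    unfolding \<Phi>_def vderiv_vderiv_cutoff_gauss q_def[symmetric]
    unfolding D_def q' B B' cutoff_gauss_def f_def[symmetric] E_def[symmetric]
    using \<epsilon>0 by (simp add: field_simps power2_eq_square)
  also have "cmod \<dots> = cmod (f 0 * (of_real (\<epsilon> ^ (N + 2)) * poly A (of_real t))
       + of_real \<delta> * (f 2 * poly B (of_real t) + (2 * f 3 - f 4) * poly B' (of_real t))) * exp (- (Re b / 2) * t\<^sup>2)"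
    by (simp only: norm_mult[of _ E] nE main)
  also have "\<dots> \<le> (1 * (\<epsilon> ^ (N + 2) * cmod (poly A (of_real t)))
       + \<delta> * (2 * cmod (poly B (of_real t)) + 36 * cmod (poly B' (of_real t)))) * exp (- (Re b / 2) * t\<^sup>2)"
  proof (intro mult_right_mono norm_triangle_le add_mono)
    have f: "cmod (f k) \<le> fact k" for k
      using flat_nonneg flat_le_fact by (simp add: f_def)
    have f0: "cmod (f 0) \<le> 1" and f2: "cmod (f 2) \<le> 2"
      using f[of 0] f[of 2] by (simp_all add: fact_numeral)
    \<comment> \<open>\<open>36 = 2 * 3! + 4!\<close>, from \<open>flat k \<le> k!\<close>.\<close>
    have "cmod (2 * f 3 - f 4) \<le> cmod (2 * f 3) + cmod (f 4)" by (rule norm_triangle_ineq4)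
    also have "\<dots> \<le> 36" using f[of 3] f[of 4] by (simp add: norm_mult fact_numeral)
    finally have f34: "cmod (2 * f 3 - f 4) \<le> 36" .
    show "cmod (f 0 * (of_real (\<epsilon> ^ (N + 2)) * poly A (of_real t))) \<le>
        1 * (\<epsilon> ^ (N + 2) * cmod (poly A (of_real t)))"
      using \<epsilon> f0 by (simp only: norm_mult norm_of_real abs_of_pos zero_less_power) (intro mult_right_mono, auto)
    have "cmod (f 2 * poly B (of_real t) + (2 * f 3 - f 4) * poly B' (of_real t)) \<le>
        2 * cmod (poly B (of_real t)) + 36 * cmod (poly B' (of_real t))"
      using f2 f34 by (intro norm_triangle_le add_mono) (simp_all add: norm_mult mult_right_mono)
    then show "cmod (of_real \<delta> * (f 2 * poly B (of_real t) + (2 * f 3 - f 4) * poly B' (of_real t))) \<le>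
        \<delta> * (2 * cmod (poly B (of_real t)) + 36 * cmod (poly B' (of_real t)))"
      using \<delta> by (simp only: norm_mult[of "of_real \<delta>"] norm_of_real abs_of_nonneg mult_left_mono)
  qed simp
  finally show ?thesis unfolding V_def by simp
qed

section \<open>The rescaled potential at a real phase space point\<close>

text \<open>Choosing solutions \<open>y\<close> that are nearest to \<open>l\<close> up to \<open>1 / r\<close> gives one family that works for
  all \<open>e\<close> simultaneously.\<close>

lemma tendsto_choice_at_top:
  fixes P :: "real \<Rightarrow> real \<Rightarrow> bool"
  assumes "\<And>e. e > 0 \<Longrightarrow> \<forall>\<^sub>F r in at_top. \<exists>y. P r y \<and> \<bar>y - l\<bar> < e"
  obtains a where "(a \<longlongrightarrow> l) at_top" "\<forall>\<^sub>F r in at_top. P r (a r)"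
proof -
  define S where "S r = (\<lambda>y. \<bar>y - l\<bar>) ` {y. P r y}" for r
  define a where "a r = (SOME y. P r y \<and> \<bar>y - l\<bar> < Inf (S r) + 1 / r)" for r
  have bdd: "bdd_below (S r)" for r
    by (auto simp: S_def intro!: bdd_belowI[of _ 0])
  have a: "P r (a r) \<and> \<bar>a r - l\<bar> < \<bar>y - l\<bar> + 1 / r" if "P r y" "r > 0" for r y
  proof -
    have "\<exists>x\<in>S r. x < Inf (S r) + 1 / r"
      using that by (intro cInf_lessD) (auto simp: S_def)
    then have "\<exists>y. P r y \<and> \<bar>y - l\<bar> < Inf (S r) + 1 / r"
      by (auto simp: S_def)
    then have "P r (a r) \<and> \<bar>a r - l\<bar> < Inf (S r) + 1 / r"
      unfolding a_def by (rule someI_ex)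
    moreover have "Inf (S r) \<le> \<bar>y - l\<bar>"
      using that bdd by (intro cInf_lower) (auto simp: S_def)
    ultimately show ?thesis by linarith
  qed
  show ?thesis
  proof
    show "\<forall>\<^sub>F r in at_top. P r (a r)"
      using assms[OF zero_less_one] eventually_gt_at_top[of 0]
      by eventually_elim (use a in blast)
    show "(a \<longlongrightarrow> l) at_top"
    proof (rule tendstoI)
      fix e :: real assume "e > 0"
      then have "\<forall>\<^sub>F r in at_top. \<exists>y. P r y \<and> \<bar>y - l\<bar> < e / 2"
        by (intro assms) auto
      then show "\<forall>\<^sub>F r in at_top. dist (a r) l < e"
        using eventually_gt_at_top[of "2 / e"]
      proof eventually_elim
        case (elim r)
        then obtain y where y: "P r y" "\<bar>y - l\<bar> < e / 2" by blast
        have "r > 0" using elim(2) \<open>e > 0\<close> by (meson divide_pos_pos less_trans zero_less_numeral)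
        then have "1 / r < e / 2" using elim(2) \<open>e > 0\<close> by (simp add: field_simps)
        then show ?case using a[OF y(1) \<open>r > 0\<close>] y(2) by (simp add: dist_real_def)
      qed
    qed
  qed
qed

text \<open>The polynomial \<open>\<zeta> \<mapsto> (V (r\<^sup>2 (a + \<zeta>)) - \<sigma> z) / \<sigma>\<close> with \<open>\<sigma> = r ^ (2 n)\<close>. All scales are
  integer powers of \<open>r\<close>, even those that are fractional powers of \<open>\<sigma>\<close>.\<close>

definition scaled_potential ::
    "nat \<Rightarrow> (nat \<Rightarrow> complex) \<Rightarrow> complex \<Rightarrow> real \<Rightarrow> real \<Rightarrow> complex poly" where
  "scaled_potential n c z r a =
     (\<Sum>m=1..n. smult (c m * of_real ((1 / r\<^sup>2) ^ (n - m))) ([:of_real a, 1:] ^ m)) - [:z:]"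

lemma poly_scaled_potential:
  assumes "r > 0"
  shows "of_real (r ^ (2 * n)) * poly (scaled_potential n c z r a) \<zeta> =
    (\<Sum>m=1..n. c m * (of_real (r\<^sup>2) * (of_real a + \<zeta>)) ^ m) - of_real (r ^ (2 * n)) * z"
proof -
  have *: "complex_of_real (r ^ (2 * n)) * of_real ((1 / r\<^sup>2) ^ (n - m)) = of_real (r\<^sup>2) ^ m"
    if "m \<in> {1..n}" for m
  proof -
    have "r ^ (2 * n) = (r\<^sup>2) ^ (n - m) * (r\<^sup>2) ^ m"
      using that by (simp add: power_mult flip: power_add)
    then have "r ^ (2 * n) * (1 / r\<^sup>2) ^ (n - m) = (r\<^sup>2) ^ m"
      using assms by (simp add: power_one_over)
    then show ?thesis by (metis of_real_mult of_real_power)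
  qed
  have "of_real (r ^ (2 * n)) * poly (scaled_potential n c z r a) \<zeta> =
     (\<Sum>m=1..n. c m * (of_real (r ^ (2 * n)) * of_real ((1 / r\<^sup>2) ^ (n - m))) * (of_real a + \<zeta>) ^ m)
     - of_real (r ^ (2 * n)) * z"
    by (simp add: scaled_potential_def poly_sum sum_distrib_left right_diff_distrib mult_ac del: of_real_power)
  also have "\<dots> = (\<Sum>m=1..n. c m * (of_real (r\<^sup>2) * (of_real a + \<zeta>)) ^ m) - of_real (r ^ (2 * n)) * z"
    by (intro arg_cong2[where f = minus] sum.cong refl)
      (simp only: * power_mult_distrib mult.assoc)
  finally show ?thesis .
qed

lemma degree_scaled_potential: "degree (scaled_potential n c z r a) \<le> n"
proof -
  have "degree ([:complex_of_real a, 1:] ^ m) \<le> n" if "m \<le> n" for m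
    using that degree_power_le[of "[:complex_of_real a, 1:]" m] by simp
  then show ?thesis
    unfolding scaled_potential_def by (intro degree_diff_le degree_sum_le) auto
qed

lemma poly_tendsto_scaled_potential:
  assumes "n > 0" "(a \<longlongrightarrow> l) at_top"
  shows "poly_tendsto (\<lambda>r. scaled_potential n c z r (a r))
           (smult (c n) ([:of_real l, 1:] ^ n) - [:z:]) at_top"
proof -
  have *: "((\<lambda>r::real. c m * of_real ((1 / r\<^sup>2) ^ (n - m))) \<longlongrightarrow> (if m = n then c n else 0)) at_top"
    if "m \<in> {1..n}" for m
  proof (cases "m = n")
    case False
    then have "n - m > 0" using that by auto
    moreover have "((\<lambda>r::real. 1 / r\<^sup>2) \<longlongrightarrow> 0) at_top"
      by (intro tendsto_divide_0[OF tendsto_const] filterlim_at_top_imp_at_infinity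
        filterlim_pow_at_top filterlim_ident) auto
    ultimately have "((\<lambda>r::real. (1 / r\<^sup>2) ^ (n - m)) \<longlongrightarrow> 0) at_top"
      by (auto intro!: tendsto_eq_intros simp: power_0_left)
    then have "((\<lambda>r::real. c m * of_real ((1 / r\<^sup>2) ^ (n - m))) \<longlongrightarrow> c m * of_real 0) at_top"
      by (intro tendsto_intros)
    then show ?thesis using False by simp
  qed simp
  have "poly_tendsto (\<lambda>r. scaled_potential n c z r (a r))
      ((\<Sum>m=1..n. smult (if m = n then c n else 0) ([:of_real l, 1:] ^ m)) - [:z:]) at_top"
    unfolding scaled_potential_def using * assms(2)
    by (intro poly_tendsto_diff poly_tendsto_sum poly_tendsto_smult poly_tendsto_power
      poly_tendsto_pCons poly_tendsto_const tendsto_of_real) auto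
  also have "(\<Sum>m=1..n. smult (if m = n then c n else 0) ([:of_real l, 1:] ^ m)) =
      smult (c n) ([:of_real l, 1:] ^ n)"
  proof -
    have "(\<Sum>m=1..n. smult (if m = n then c n else 0) ([:complex_of_real l, 1:] ^ m)) =
       (\<Sum>m=1..n. if m = n then smult (c n) ([:of_real l, 1:] ^ m) else 0)"
      by (intro sum.cong) auto
    also have "\<dots> = smult (c n) ([:of_real l, 1:] ^ n)"
      using assms(1) by (subst sum.delta) auto
    finally show ?thesis .
  qed
  finally show ?thesis .
qed

text \<open>The second claim says \<open>Im (w * cnj z) > 0\<close>.\<close>

lemma Arg_less_imp:
  assumes "0 < Arg z" "Arg z < Arg w" "Im w > 0"
  shows "Im z > 0" "Re w * Im z < Im w * Re z"
proof -
  have w: "w \<noteq> 0" using assms by auto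
  have z: "z \<noteq> 0" using assms by (auto simp: Arg_zero)
  have "Arg w < pi" using Arg_lt_pi[of w] assms by auto
  then have sin: "sin (Arg z) > 0" "sin (Arg w - Arg z) > 0"
    using assms by (auto intro!: sin_gt_zero)
  have eq: "u = of_real (cmod u) * cis (Arg u)" if "u \<noteq> 0" for u
    using Arg_eq[OF that] by (simp add: cis_conv_exp)
  have z': "Re z = cmod z * cos (Arg z)" "Im z = cmod z * sin (Arg z)"
    by (subst eq[OF z], simp)+
  have w': "Re w = cmod w * cos (Arg w)" "Im w = cmod w * sin (Arg w)"
    by (subst eq[OF w], simp)+
  show "Im z > 0"
    using z sin by (simp add: z'(2))
  have "Im w * Re z - Re w * Im z = (cmod w * cmod z) * sin (Arg w - Arg z)"
    by (simp add: w' z' sin_diff algebra_simps)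
  also have "\<dots> > 0" using w z sin by simp
  finally show "Re w * Im z < Im w * Re z" by simp
qed

text \<open>For the limit polynomial the point is \<open>l = root n (Im z / Im (c n))\<close>, and the hypothesis on
  \<open>Re\<close> and \<open>Im\<close> gives the sign of the real part there. The imaginary part changes sign at \<open>l\<close>, so
  by the intermediate value theorem the real points persist under the lower order terms. An exact
  zero is needed for each \<open>r\<close>: those terms have relative size \<open>r ^ -2\<close>, which for \<open>n \<ge> 2\<close> is no
  smaller than \<open>\<epsilon>\<close>.\<close>

lemma real_phase_point_exists:
  assumes n: "n > 0" and cn: "Im (c n) > 0" and z: "Im z > 0" and turn: "Re (c n) * Im z < Im (c n) * Re z"
  obtains a l where "(a \<longlongrightarrow> l) at_top" "l > 0"
    "\<forall>\<^sub>F r in at_top. Im (poly (scaled_potential n c z r (a r)) 0) = 0"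
    "Im (c n * of_real l ^ n - z) = 0" "Re (c n * of_real l ^ n - z) < 0"
proof -
  define l where "l = root n (Im z / Im (c n))"
  have l: "l > 0" "l ^ n = Im z / Im (c n)"
    using n cn z by (auto simp: l_def)
  have lim: "((\<lambda>r. Im (poly (scaled_potential n c z r y) 0)) \<longlongrightarrow> Im (c n) * y ^ n - Im z) at_top" for y
  proof -
    have "((\<lambda>r. poly (scaled_potential n c z r y) 0) \<longlongrightarrow>
        poly (smult (c n) ([:of_real y, 1:] ^ n) - [:z:]) 0) at_top"
      by (intro poly_tendsto_poly poly_tendsto_scaled_potential n tendsto_const)
    from tendsto_Im[OF this] show ?thesis by (simp flip: of_real_power)
  qed
  have near: "\<forall>\<^sub>F r in at_top. \<exists>y. Im (poly (scaled_potential n c z r y) 0) = 0 \<and> \<bar>y - l\<bar> < e"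
    if "e > 0" for e
  proof -
    define d where "d = min (e / 2) (l / 2)"
    have d: "d > 0" "d < e" "d < l" using that l by (auto simp: d_def)
    have "Im (c n) * (l - d) ^ n - Im z < Im (c n) * l ^ n - Im z"
      by (intro diff_strict_right_mono mult_strict_left_mono power_strict_mono) (use d n cn in auto)
    then have neg: "Im (c n) * (l - d) ^ n - Im z < 0" using cn l by simp
    have "Im (c n) * l ^ n - Im z < Im (c n) * (l + d) ^ n - Im z"
      by (intro diff_strict_right_mono mult_strict_left_mono power_strict_mono) (use d l n cn in auto)
    then have pos: "Im (c n) * (l + d) ^ n - Im z > 0" using cn l by simp
    show ?thesis
      using order_tendstoD(2)[OF lim neg] order_tendstoD(1)[OF lim pos]
    proof eventually_elim
      case (elim r)
      have "\<exists>y\<ge>l - d. y \<le> l + d \<and> Im (poly (scaled_potential n c z r y) 0) = 0"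
        using elim d
        by (intro IVT' continuous_intros)
          (auto simp: scaled_potential_def poly_sum intro!: continuous_intros)
      then show ?case using d by force
    qed
  qed
  obtain a where a: "(a \<longlongrightarrow> l) at_top"
    "\<forall>\<^sub>F r in at_top. Im (poly (scaled_potential n c z r (a r)) 0) = 0"
    using tendsto_choice_at_top[OF near] by blast
  show ?thesis
  proof (rule that[OF a(1) l(1) a(2)])
    show "Im (c n * of_real l ^ n - z) = 0"
      using l cn by (simp flip: of_real_power)
    have "Re (c n) * (Im z / Im (c n)) < Re z"
      using turn cn by (simp add: field_simps)
    then show "Re (c n * of_real l ^ n - z) < 0"
      using l cn by (simp flip: of_real_power)
  qed
qed

section \<open>Quasimodes and growth of the resolvent\<close>

text \<open>The change of variables \<open>x = r\<^sup>2 (a + \<epsilon> t)\<close>, that is \<open>t = \<tau> (x - y)\<close> with \<open>\<tau> = r ^ (m - 1)\<close>,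
  carries a wave packet in \<open>t\<close> to a test function in \<open>x\<close>. The Jacobian scales both \<open>L\<^sup>2\<close> norms
  alike and drops out. The factor \<open>sqrt \<rho>\<close> compares the interval \<open>\<bar>t\<bar> \<le> 1\<close>, on which the packet is
  large, with the support \<open>\<bar>t\<bar> \<le> 1 / \<rho>\<close>.\<close>

lemma resolvent_norm_ge_quasimode:
  fixes r a \<epsilon> \<rho> M M' :: real
  assumes H: "closed_schrodinger_extension n c D H" and n: "n = 2 * m" "m > 0"
    and r: "r > 0" and \<epsilon>: "\<epsilon> = 1 / r ^ (m + 1)" and \<rho>: "\<rho> > 0"
    and \<Phi>: "\<Phi> = cutoff_gauss (\<rho>\<^sup>2) q 0 p"
    and small: "\<And>t. cmod (- of_real (\<epsilon>\<^sup>2) * (vderiv ^^ 2) \<Phi> t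
      + poly (scaled_potential n c z r a) (of_real (\<epsilon> * t)) * \<Phi> t) \<le> M" "M > 0"
    and large: "\<And>t. \<bar>t\<bar> \<le> 1 \<Longrightarrow> M' \<le> cmod (\<Phi> t)" "M' \<ge> 0"
  shows "ereal (sqrt \<rho> * M' / (r ^ (2 * n) * M)) \<le> resolvent_norm D H (of_real (r ^ (2 * n)) * z)"
proof -
  define \<tau> y where "\<tau> = r ^ (m - 1)" and "y = r\<^sup>2 * a"
  define f where "f x = \<Phi> (\<tau> * (x - y))" for x
  have \<tau>: "\<tau> > 0" using r by (simp add: \<tau>_def)
  have r_\<epsilon>: "r\<^sup>2 * \<epsilon> * \<tau> = 1" "\<tau>\<^sup>2 = r ^ (2 * n) * \<epsilon>\<^sup>2"
  proof -
    obtain i where "m = Suc i" using n by (cases m) auto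
    then have i: "\<tau> = r ^ i" "\<epsilon> = 1 / r ^ (i + 2)" "2 * n = i * 2 + (i + 2) * 2"
      by (simp_all add: \<tau>_def \<epsilon> n)
    show "r\<^sup>2 * \<epsilon> * \<tau> = 1"
      using r by (simp add: i power_add power2_eq_square)
    show "\<tau>\<^sup>2 = r ^ (2 * n) * \<epsilon>\<^sup>2"
      unfolding i power_add[of r "i * 2"] power_mult using r by (simp add: power_divide)
  qed
  have test: "test_function \<Phi>" unfolding \<Phi> by (rule test_function_cutoff_gauss[OF \<rho>])
  have smooth: "(vderiv ^^ k) \<Phi> differentiable at x" for k x
    using test by (simp add: test_function_def)
  have \<Phi>0: "\<Phi> t = 0" if "\<bar>t\<bar> > 1 / \<rho>" for t
    unfolding \<Phi> using \<rho> that by (rule cutoff_gauss_eq_0)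
  have "test_function f"
    unfolding f_def[abs_def] by (rule test_function_affine[OF smooth \<Phi>0 \<tau>])
  moreover have "f x = 0" if "\<bar>x - y\<bar> > 1 / (\<rho> * \<tau>)" for x
    using that \<tau> \<rho> unfolding f_def by (intro \<Phi>0) (simp add: abs_mult pos_divide_less_eq mult_ac)
  moreover have "cmod (schrodinger n c f x - of_real (r ^ (2 * n)) * z * f x) \<le> r ^ (2 * n) * M" for x
  proof -
    define t where "t = \<tau> * (x - y)"
    have "r\<^sup>2 * (a + \<epsilon> * t) = y + (r\<^sup>2 * \<epsilon> * \<tau>) * (x - y)"
      by (simp add: y_def t_def algebra_simps)
    then have "r\<^sup>2 * (a + \<epsilon> * t) = x"
      unfolding r_\<epsilon>(1) by simp
    then have x: "of_real (r\<^sup>2) * (of_real a + of_real (\<epsilon> * t)) = complex_of_real x"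
      by (simp only: flip: of_real_add of_real_mult)
    have "(vderiv ^^ 2) f x = of_real (r ^ (2 * n) * \<epsilon>\<^sup>2) * (vderiv ^^ 2) \<Phi> t"
      unfolding f_def[abs_def] vderiv_affine(2)[OF smooth] r_\<epsilon>(2) t_def ..
    then have "schrodinger n c f x - of_real (r ^ (2 * n)) * z * f x =
      - of_real (r ^ (2 * n) * \<epsilon>\<^sup>2) * (vderiv ^^ 2) \<Phi> t
      + ((\<Sum>m=1..n. c m * of_real x ^ m) - of_real (r ^ (2 * n)) * z) * \<Phi> t"
      by (simp add: schrodinger_def f_def t_def sum_distrib_right left_diff_distrib)
    also have "\<dots> = of_real (r ^ (2 * n)) * (- of_real (\<epsilon>\<^sup>2) * (vderiv ^^ 2) \<Phi> t
      + poly (scaled_potential n c z r a) (of_real (\<epsilon> * t)) * \<Phi> t)"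
      unfolding x[symmetric] poly_scaled_potential[OF r, symmetric] by (simp add: algebra_simps)
    also have "cmod \<dots> \<le> r ^ (2 * n) * M"
      using r small(1)[of t] by (simp only: norm_mult norm_of_real abs_of_pos zero_less_power mult_left_mono less_imp_le)
    finally show ?thesis .
  qed
  moreover have "M' \<le> cmod (f x)" if "\<bar>x - y\<bar> \<le> 1 / \<tau>" for x
    using that \<tau> unfolding f_def by (intro large(1)) (simp add: abs_mult pos_le_divide_eq mult_ac)
  ultimately have "ereal (sqrt (2 * (1 / \<tau>)) * M' / (sqrt (2 * (1 / (\<rho> * \<tau>))) * (r ^ (2 * n) * M)))
      \<le> resolvent_norm D H (of_real (r ^ (2 * n)) * z)"
    using \<tau> \<rho> r small(2) large(2)
    by (intro resolvent_norm_ge_test_function[OF H, where y = y and f = f]) auto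
  moreover have "sqrt (2 * (1 / \<tau>)) = sqrt \<rho> * sqrt (2 * (1 / (\<rho> * \<tau>)))"
    using \<rho> by (simp flip: real_sqrt_mult)
  moreover have "sqrt (2 * (1 / (\<rho> * \<tau>))) > 0"
    using \<rho> \<tau> by simp
  ultimately show ?thesis using \<rho> \<tau> by simp
qed

lemma poly_taylor_split:
  fixes p :: "complex poly"
  assumes "degree p \<le> n" "n > 0"
  shows "poly p (e * t) = coeff p 0 + e * coeff p 1 * t
    + e\<^sup>2 * poly (\<Sum>i=2..n. smult (coeff p i * e ^ (i - 2)) (monom 1 i)) t"
proof -
  have "poly p (e * t) = (\<Sum>i\<in>{0..n}. coeff p i * (e * t) ^ i)"
    using poly_eq_sum_coeff[OF assms(1)] by (simp add: atMost_atLeast0)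
  also have "{0..n} = insert 0 (insert 1 {2..n})"
    using assms(2) by auto
  also have "(\<Sum>i\<in>insert 0 (insert 1 {2..n}). coeff p i * (e * t) ^ i) =
      coeff p 0 + e * coeff p 1 * t + (\<Sum>i=2..n. coeff p i * (e * t) ^ i)"
    by simp
  also have "(\<Sum>i=2..n. coeff p i * (e * t) ^ i) = (\<Sum>i=2..n. e\<^sup>2 * (coeff p i * e ^ (i - 2) * t ^ i))"
  proof (intro sum.cong refl)
    fix i assume "i \<in> {2..n}"
    then have "e ^ i = e ^ (2 + (i - 2))"
      by (intro arg_cong[where f = "(^) e"]) auto
    also have "\<dots> = e\<^sup>2 * e ^ (i - 2)" by (rule power_add)
    finally show "coeff p i * (e * t) ^ i = e\<^sup>2 * (coeff p i * e ^ (i - 2) * t ^ i)"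
      by (simp add: power_mult_distrib)
  qed
  finally show ?thesis
    by (simp add: poly_sum poly_monom sum_distrib_left)
qed

lemma poly_tendsto_transport_op:
  assumes "(b \<longlongrightarrow> b') F" "poly_tendsto Q Q' F" "poly_tendsto P L F"
  shows "poly_tendsto (\<lambda>r. transport_op (b r) (Q r) (P r)) (transport_op b' Q' L) F"
  unfolding transport_op_def
  by (intro poly_tendsto_add poly_tendsto_minus poly_tendsto_mult poly_tendsto_pderiv
    poly_tendsto_pCons poly_tendsto_const tendsto_intros assms)

lemma poly_tendsto_transport_step:
  assumes "(\<mu> \<longlongrightarrow> \<mu>') F" "\<mu>' \<noteq> 0" "(b \<longlongrightarrow> b') F" "poly_tendsto Q Q' F" "poly_tendsto P L F"
  shows "poly_tendsto (\<lambda>r. transport_step (\<mu> r) (b r) (Q r) (P r)) (transport_step \<mu>' b' Q' L) F"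
  unfolding transport_step_def
  by (intro poly_tendsto_smult poly_tendsto_prim poly_tendsto_transport_op tendsto_intros assms)

lemma poly_tendsto_transport_step_iterate:
  assumes "(\<mu> \<longlongrightarrow> \<mu>') F" "\<mu>' \<noteq> 0" "(b \<longlongrightarrow> b') F" "poly_tendsto Q Q' F"
  shows "poly_tendsto (\<lambda>r. (transport_step (\<mu> r) (b r) (Q r) ^^ N) 1) ((transport_step \<mu>' b' Q' ^^ N) 1) F"
  by (induction N) (use assms in \<open>auto intro: poly_tendsto_transport_step\<close>)

lemma poly_tendsto_amplitude:
  assumes "(e \<longlongrightarrow> e') F" "(\<mu> \<longlongrightarrow> \<mu>') F" "\<mu>' \<noteq> 0" "(b \<longlongrightarrow> b') F" "poly_tendsto Q Q' F"
  shows "poly_tendsto (\<lambda>r. amplitude (e r) (\<mu> r) (b r) (Q r) N) (amplitude e' \<mu>' b' Q' N) F"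
  by (induction N)
    (use assms in \<open>auto intro!: poly_tendsto_add poly_tendsto_smult poly_tendsto_transport_step\<close>)

lemma cutoff_gauss_lower_bound:
  fixes \<epsilon> \<eta> t :: real
  assumes "0 \<le> \<delta>" "\<delta> \<le> 1 / 2" "\<bar>t\<bar> \<le> 1" "Re b \<le> B" "cmod (poly p (of_real t)) \<ge> 1 / 2" "B \<ge> 0"
  shows "exp (- 2) * (1 / 2) * exp (- B) \<le>
    cmod (cutoff_gauss \<delta> [:0, \<i> * of_real \<eta> / of_real \<epsilon>, - b / 2:] 0 p t)"
proof -
  have t2: "0 \<le> t\<^sup>2" "t\<^sup>2 \<le> 1" using assms(3) by (auto simp: abs_square_le_1)
  have "\<delta> * t\<^sup>2 \<le> 1 / 2" using mult_mono[OF assms(2) t2(2)] t2 by simp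
  then have "exp (- 2) \<le> flat 0 (1 - \<delta> * t\<^sup>2)"
    by (simp add: flat_def field_simps)
  moreover have "exp (- B) \<le> exp (- (Re b / 2) * t\<^sup>2)"
  proof -
    have "Re b / 2 * t\<^sup>2 \<le> B * 1"
      using assms t2 by (intro mult_mono) auto
    then show ?thesis by simp
  qed
  ultimately show ?thesis
    using assms(5) flat_nonneg[of 0 "1 - \<delta> * t\<^sup>2"] unfolding cutoff_gauss_def norm_mult norm_exp_phase
    by (intro mult_mono) auto
qed

text \<open>With \<open>2 j + 1\<close> transport steps and \<open>\<rho> = \<epsilon> ^ (2 j + 2)\<close> the residual is \<open>O(\<sigma> \<epsilon> ^ (2 j + 3))\<close>
  in supremum norm. The loss of \<open>sqrt \<rho> = \<epsilon> ^ (j + 1)\<close> leaves \<open>\<epsilon> ^ -(j + 2) / \<sigma>\<close> for the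
  resolvent.\<close>

lemma resolvent_norm_ge_power:
  assumes H: "closed_schrodinger_extension n c D H" and n: "n = 2 * m" "m > 0"
    and cn: "Im (c n) > 0" and z: "Im z > 0" "Re (c n) * Im z < Im (c n) * Re z"
  shows "\<exists>C>0. \<forall>\<^sub>F r in at_top.
    ereal (C * r ^ ((m + 1) * (j + 2)) / r ^ (2 * n)) \<le> resolvent_norm D H (of_real (r ^ (2 * n)) * z)"
proof -
  have n0: "n > 0" using n by simp
  obtain a l where a: "(a \<longlongrightarrow> l) at_top" and l: "l > 0"
    and real: "\<forall>\<^sub>F r in at_top. Im (poly (scaled_potential n c z r (a r)) 0) = 0"
    and l0: "Im (c n * of_real l ^ n - z) = 0" "Re (c n * of_real l ^ n - z) < 0"
    by (rule real_phase_point_exists[where n = n and c = c and z = z]) (use n0 cn z in auto)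
  define W where "W r = scaled_potential n c z r (a r)" for r
  define W' where "W' = smult (c n) ([:complex_of_real l, 1:] ^ n) - [:z:]"
  have W: "poly_tendsto W W' at_top"
    unfolding W_def[abs_def] W'_def by (rule poly_tendsto_scaled_potential[OF n0 a])
  have degree_W: "degree (W r) \<le> n" for r
    by (simp add: W_def degree_scaled_potential)
  have W'0: "coeff W' 0 = c n * of_real l ^ n - z"
    by (simp add: W'_def flip: poly_0_coeff_0)
  have "coeff W' 1 = poly (pderiv W') 0"
    by (simp add: poly_0_coeff_0 coeff_pderiv)
  also have "\<dots> = c n * of_real (n * l ^ (n - 1))"
    by (simp add: W'_def pderiv_diff pderiv_smult pderiv_power pderiv_pCons)
  finally have W'1: "Im (coeff W' 1) > 0"
    using cn l n0 by simp

  define \<epsilon> :: "real \<Rightarrow> real" where "\<epsilon> r = 1 / r ^ (m + 1)" for r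
  \<comment> \<open>The negative root makes \<open>Re b\<close> positive, so that the packet decays.\<close>
  define \<eta> where "\<eta> r = - sqrt (- Re (coeff (W r) 0))" for r
  define \<eta>' where "\<eta>' = - sqrt (- Re (coeff W' 0))"
  define \<mu> where "\<mu> r = 2 * \<i> * complex_of_real (\<eta> r)" for r
  define \<mu>' where "\<mu>' = 2 * \<i> * complex_of_real \<eta>'"
  define b where "b r = - coeff (W r) 1 / \<mu> r" for r
  define b' where "b' = - coeff W' 1 / \<mu>'"
  define Q where "Q r = (\<Sum>i=2..n. smult (coeff (W r) i * of_real (\<epsilon> r) ^ (i - 2)) (monom 1 i))" for r
  define Q' :: "complex poly" where "Q' = (\<Sum>i=2..n. smult (coeff W' i * of_real 0 ^ (i - 2)) (monom 1 i))"
  define p where "p r = amplitude (of_real (\<epsilon> r)) (\<mu> r) (b r) (Q r) (Suc (2 * j))" for r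
  \<comment> \<open>\<open>p = 1 + \<epsilon> s\<close>, used to bound \<open>p\<close> away from \<open>0\<close> near the centre.\<close>
  define s where "s r = transport_step (\<mu> r) (b r) (Q r)
    (amplitude (of_real (\<epsilon> r)) (\<mu> r) (b r) (Q r) (2 * j))" for r
  define A where "A r = transport_op (b r) (Q r) ((transport_step (\<mu> r) (b r) (Q r) ^^ Suc (2 * j)) 1)" for r
  define \<rho> where "\<rho> r = \<epsilon> r ^ (2 * j + 2)" for r
  define B where "B r = smult (2 * (of_real (\<epsilon> r))^2) (p r)
    + [:0, 4:] * (smult ((of_real (\<epsilon> r))^2) (pderiv (p r))
      + [:\<i> * of_real (\<eta> r * \<epsilon> r), - ((of_real (\<epsilon> r))^2) * b r:] * p r)" for r
  define B' where "B' r = smult (of_real (4 * (\<rho> r)\<^sup>2 * (\<epsilon> r)^2)) ([:0, 0, 1:] * p r)" for r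

  have \<epsilon>: "(\<epsilon> \<longlongrightarrow> 0) at_top"
    unfolding \<epsilon>_def[abs_def]
    by (intro tendsto_divide_0[OF tendsto_const] filterlim_at_top_imp_at_infinity
        filterlim_pow_at_top filterlim_ident) auto
  have \<eta>: "(\<eta> \<longlongrightarrow> \<eta>') at_top"
    unfolding \<eta>_def[abs_def] \<eta>'_def by (intro tendsto_intros poly_tendsto_coeff W)
  have \<eta>'0: "\<eta>' < 0" using l0 by (simp add: \<eta>'_def W'0)
  then have \<mu>'0: "\<mu>' \<noteq> 0" by (simp add: \<mu>'_def)
  have \<mu>: "(\<mu> \<longlongrightarrow> \<mu>') at_top"
    unfolding \<mu>_def[abs_def] \<mu>'_def by (intro tendsto_intros \<eta>)
  have b: "(b \<longlongrightarrow> b') at_top"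
    unfolding b_def[abs_def] b'_def by (intro tendsto_intros \<mu> \<mu>'0 poly_tendsto_coeff W)
  have "Re b' = - Im (coeff W' 1) / (2 * \<eta>')"
    using \<eta>'0 by (simp add: b'_def \<mu>'_def Re_divide power2_eq_square field_simps)
  then have b'0: "Re b' > 0"
    using \<eta>'0 W'1 by (simp add: divide_pos_neg)
  have Q: "poly_tendsto Q Q' at_top"
    unfolding Q_def[abs_def] Q'_def
    by (intro poly_tendsto_sum poly_tendsto_smult poly_tendsto_const tendsto_intros poly_tendsto_coeff W \<epsilon>)
  have \<epsilon>c: "((\<lambda>r. complex_of_real (\<epsilon> r)) \<longlongrightarrow> of_real 0) at_top"
    by (intro tendsto_intros \<epsilon>)
  have p: "\<exists>L. poly_tendsto p L at_top"
    unfolding p_def[abs_def] by (intro exI, rule poly_tendsto_amplitude[OF \<epsilon>c \<mu> \<mu>'0 b Q])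
  then obtain p' where p': "poly_tendsto p p' at_top" by blast
  have \<rho>: "(\<rho> \<longlongrightarrow> 0 ^ (2 * j + 2)) at_top"
    unfolding \<rho>_def[abs_def] by (intro tendsto_intros \<epsilon>)
  \<comment> \<open>Half of the decay rate \<open>Re b' / 2\<close> of the limiting packet leaves room for \<open>b r \<noteq> b'\<close>.\<close>
  have bound: "\<exists>C>0. \<forall>\<^sub>F r in at_top. \<forall>t::real. cmod (poly (P r) (of_real t)) * exp (- (Re b' / 4) * t\<^sup>2) \<le> C"
    if "\<exists>L. poly_tendsto P L at_top" for P
    using that b'0 poly_tendsto_gauss_bound[where \<beta> = "Re b' / 4" and F = at_top and P = P] by auto
  obtain C\<^sub>s where C\<^sub>s: "C\<^sub>s > 0" "\<forall>\<^sub>F r in at_top. \<forall>t::real. cmod (poly (s r) (of_real t)) * exp (- (Re b' / 4) * t\<^sup>2) \<le> C\<^sub>s"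
  proof -
    have "\<exists>L. poly_tendsto s L at_top"
      unfolding s_def[abs_def]
      by (intro exI, rule poly_tendsto_transport_step[OF \<mu> \<mu>'0 b Q poly_tendsto_amplitude[OF \<epsilon>c \<mu> \<mu>'0 b Q]])
    then show thesis using bound that by blast
  qed
  obtain C\<^sub>1 where C\<^sub>1: "C\<^sub>1 > 0" "\<forall>\<^sub>F r in at_top. \<forall>t::real. cmod (poly (A r) (of_real t)) * exp (- (Re b' / 4) * t\<^sup>2) \<le> C\<^sub>1"
  proof -
    have "\<exists>L. poly_tendsto A L at_top"
      unfolding A_def[abs_def]
      by (intro exI, rule poly_tendsto_transport_op[OF b Q poly_tendsto_transport_step_iterate[OF \<mu> \<mu>'0 b Q]])
    then show thesis using bound that by blast
  qed
  obtain C\<^sub>2 where C\<^sub>2: "C\<^sub>2 > 0" "\<forall>\<^sub>F r in at_top. \<forall>t::real. cmod (poly (B r) (of_real t)) * exp (- (Re b' / 4) * t\<^sup>2) \<le> C\<^sub>2"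
  proof -
    have "\<exists>L. poly_tendsto B L at_top"
      unfolding B_def[abs_def]
      by (rule exI, (rule poly_tendsto_add poly_tendsto_smult poly_tendsto_mult poly_tendsto_pderiv
          poly_tendsto_pCons poly_tendsto_const tendsto_intros \<epsilon> \<eta> b p')+)
    then show thesis using bound that by blast
  qed
  obtain C\<^sub>3 where C\<^sub>3: "C\<^sub>3 > 0" "\<forall>\<^sub>F r in at_top. \<forall>t::real. cmod (poly (B' r) (of_real t)) * exp (- (Re b' / 4) * t\<^sup>2) \<le> C\<^sub>3"
  proof -
    have "\<exists>L. poly_tendsto B' L at_top"
      unfolding B'_def[abs_def]
      by (rule exI, (rule poly_tendsto_smult poly_tendsto_mult poly_tendsto_const tendsto_intros \<epsilon> \<rho> p')+)
    then show thesis using bound that by blast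
  qed
  define K where "K = C\<^sub>1 + (2 * C\<^sub>2 + 36 * C\<^sub>3)"
  have K: "K > 0" using C\<^sub>1(1) C\<^sub>2(1) C\<^sub>3(1) by (simp add: K_def)
  define M' where "M' = exp (- 2) * (1 / 2) * exp (- (2 * Re b'))"
  have M': "M' > 0" by (simp add: M'_def)

  have "\<forall>\<^sub>F r in at_top. ereal (M' / K * r ^ ((m + 1) * (j + 2)) / r ^ (2 * n))
      \<le> resolvent_norm D H (of_real (r ^ (2 * n)) * z)"
  proof -
    have "\<forall>\<^sub>F r in at_top. \<epsilon> r < min (1 / 2) (1 / (2 * C\<^sub>s * exp (Re b' / 4)))"
      using C\<^sub>s(1) by (intro order_tendstoD[OF \<epsilon>]) auto
    moreover have "\<forall>\<^sub>F r in at_top. Re (coeff (W r) 0) < 0"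
      using l0 by (intro order_tendstoD[OF tendsto_Re[OF poly_tendsto_coeff[OF W]]]) (simp add: W'0)
    moreover have "\<forall>\<^sub>F r in at_top. Re b' / 2 < Re (b r)"
      by (rule order_tendstoD[OF tendsto_Re[OF b]]) (use b'0 in simp)
    moreover have "\<forall>\<^sub>F r in at_top. Re (b r) < 2 * Re b'"
      by (rule order_tendstoD[OF tendsto_Re[OF b]]) (use b'0 in simp)
    ultimately show ?thesis
      using real eventually_gt_at_top[of 0] C\<^sub>s(2) C\<^sub>1(2) C\<^sub>2(2) C\<^sub>3(2)
    proof eventually_elim
      case (elim r)
      note r = \<open>0 < r\<close>
      have e0: "\<epsilon> r > 0" using r by (simp add: \<epsilon>_def)
      have e1: "\<epsilon> r \<le> 1 / 2" "\<epsilon> r * (C\<^sub>s * exp (Re b' / 4)) \<le> 1 / 2"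
        using elim(1) C\<^sub>s(1) by (simp_all add: field_simps)
      have \<rho>0: "\<rho> r > 0" using e0 by (simp add: \<rho>_def)
      have \<eta>r: "coeff (W r) 0 = - (of_real (\<eta> r))\<^sup>2"
        using elim(2,5) by (simp add: \<eta>_def W_def poly_0_coeff_0 complex_eq_iff flip: of_real_power)
      have "\<eta> r < 0" using elim(2) by (simp add: \<eta>_def)
      then have \<mu>r: "\<mu> r \<noteq> 0" by (simp add: \<mu>_def)
      have \<rho>2: "(\<rho> r)\<^sup>2 \<le> \<epsilon> r ^ (2 * j + 3)"
        unfolding \<rho>_def power_mult[symmetric] using e0 e1 by (intro power_decreasing) auto
      have potential: "poly (W r) (of_real (\<epsilon> r * t)) = - (of_real (\<eta> r))\<^sup>2
          + of_real (\<epsilon> r) * coeff (W r) 1 * of_real t + (of_real (\<epsilon> r))\<^sup>2 * poly (Q r) (of_real t)" for t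
        using poly_taylor_split[OF degree_W n0, of r "of_real (\<epsilon> r)" "of_real t"]
        by (simp add: Q_def flip: \<eta>r)
      have gauss: "exp (- (Re (b r) / 2) * t\<^sup>2) \<le> exp (- (Re b' / 4) * t\<^sup>2)" for t
      proof -
        have "Re b' / 4 * t\<^sup>2 \<le> Re (b r) / 2 * t\<^sup>2"
          using elim(3) by (intro mult_right_mono) auto
        then show ?thesis by simp
      qed
      define \<Phi> where "\<Phi> = cutoff_gauss ((\<rho> r)\<^sup>2) [:0, \<i> * of_real (\<eta> r) / of_real (\<epsilon> r), - b r / 2:] 0 (p r)"
      have small: "cmod (- of_real ((\<epsilon> r)\<^sup>2) * (vderiv ^^ 2) \<Phi> t
          + poly (scaled_potential n c z r (a r)) (of_real (\<epsilon> r * t)) * \<Phi> t) \<le> \<epsilon> r ^ (2 * j + 3) * K" for t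
      proof -
        let ?g = "exp (- (Re b' / 4) * t\<^sup>2)"
        have "cmod (- of_real ((\<epsilon> r)\<^sup>2) * (vderiv ^^ 2) \<Phi> t + poly (W r) (of_real (\<epsilon> r * t)) * \<Phi> t)
          \<le> (\<epsilon> r ^ (Suc (2 * j) + 2) * cmod (poly (A r) (of_real t))
            + (\<rho> r)\<^sup>2 * (2 * cmod (poly (B r) (of_real t)) + 36 * cmod (poly (B' r) (of_real t))))
            * exp (- (Re (b r) / 2) * t\<^sup>2)"
          unfolding potential \<Phi>_def
        proof (rule residual_bound)
          show "smult (of_real (\<epsilon> r)) (transport_op (b r) (Q r) (p r)) - smult (\<mu> r) (pderiv (p r)) =
            smult (of_real (\<epsilon> r) ^ Suc (Suc (2 * j))) (A r)"
            unfolding p_def A_def by (rule transport_equation_amplitude[OF \<mu>r])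
        qed (use e0 \<mu>r in \<open>simp_all add: \<mu>_def b_def B_def B'_def\<close>)
        also have "\<dots> \<le> (\<epsilon> r ^ (2 * j + 3) * cmod (poly (A r) (of_real t))
            + \<epsilon> r ^ (2 * j + 3) * (2 * cmod (poly (B r) (of_real t)) + 36 * cmod (poly (B' r) (of_real t)))) * ?g"
          using e0 by (intro mult_mono add_mono gauss \<rho>2) (auto simp: eval_nat_numeral)
        also have "\<dots> = \<epsilon> r ^ (2 * j + 3) * (cmod (poly (A r) (of_real t)) * ?g
            + (2 * (cmod (poly (B r) (of_real t)) * ?g) + 36 * (cmod (poly (B' r) (of_real t)) * ?g)))"
          by (simp only: ring_distribs mult_ac)
        also have "\<dots> \<le> \<epsilon> r ^ (2 * j + 3) * K"
          unfolding K_def using e0 elim(8-10) by (intro mult_left_mono add_mono) auto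
        finally show ?thesis by (simp add: W_def)
      qed
      have large: "M' \<le> cmod (\<Phi> t)" if t: "\<bar>t\<bar> \<le> 1" for t
        unfolding M'_def \<Phi>_def
      proof (rule cutoff_gauss_lower_bound)
        show "(\<rho> r)\<^sup>2 \<le> 1 / 2"
          using \<rho>2 power_decreasing[of 1 "2 * j + 3" "\<epsilon> r"] e0 e1 by simp
        have "cmod (poly (s r) (of_real t)) * exp (- (Re b' / 4) * t\<^sup>2) \<le> C\<^sub>s"
          using elim(7) by blast
        moreover have "exp (- (Re b' / 4)) \<le> exp (- (Re b' / 4) * t\<^sup>2)"
          using t b'0 by (simp add: abs_square_le_1 mult_left_le)
        ultimately have "cmod (poly (s r) (of_real t)) * exp (- (Re b' / 4)) \<le> C\<^sub>s"
          by (meson mult_left_mono norm_ge_zero order_trans)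
        then have "cmod (poly (s r) (of_real t)) \<le> C\<^sub>s * exp (Re b' / 4)"
          by (simp add: exp_minus field_simps)
        then have "\<epsilon> r * cmod (poly (s r) (of_real t)) \<le> 1 / 2"
          using e0 e1(2) by (meson mult_left_mono less_imp_le order_trans)
        moreover have "poly (p r) (of_real t) = 1 + of_real (\<epsilon> r) * poly (s r) (of_real t)"
          by (simp add: p_def s_def)
        ultimately show "1 / 2 \<le> cmod (poly (p r) (of_real t))"
          using norm_diff_ineq[of 1 "of_real (\<epsilon> r) * poly (s r) (of_real t)"] e0 by (simp add: norm_mult)
      qed (use t elim(4) b'0 in auto)
      have "ereal (sqrt (\<rho> r) * M' / (r ^ (2 * n) * (\<epsilon> r ^ (2 * j + 3) * K)))
          \<le> resolvent_norm D H (of_real (r ^ (2 * n)) * z)"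
        by (rule resolvent_norm_ge_quasimode[OF H n r \<epsilon>_def \<rho>0 \<Phi>_def small _ large])
          (use e0 K M' in auto)
      moreover have "sqrt (\<rho> r) * M' / (r ^ (2 * n) * (\<epsilon> r ^ (2 * j + 3) * K)) =
          M' / K * r ^ ((m + 1) * (j + 2)) / r ^ (2 * n)"
      proof -
        have "\<rho> r = (\<epsilon> r ^ (j + 1))\<^sup>2"
          unfolding \<rho>_def power_mult[symmetric] by (intro arg_cong[where f = "(^) (\<epsilon> r)"]) simp
        then have "sqrt (\<rho> r) = \<epsilon> r ^ (j + 1)" using e0 by simp
        moreover have "\<epsilon> r ^ (2 * j + 3) = \<epsilon> r ^ (j + 1) * \<epsilon> r ^ (j + 2)"
          by (simp flip: power_add add: eval_nat_numeral)
        moreover have "r ^ ((m + 1) * (j + 2)) = 1 / \<epsilon> r ^ (j + 2)"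
          unfolding \<epsilon>_def power_mult power_one_over by simp
        moreover have "X * M' / (R * (X * Y * K)) = M' / K * (1 / Y) / R" if "X > 0" for X Y R :: real
          using that by simp
        ultimately show ?thesis
          using e0 by (simp only: zero_less_power)
      qed
      ultimately show ?case by simp
    qed
  qed
  then show ?thesis
    using K M' by (intro exI[of _ "M' / K"]) auto
qed

theorem theorem2:
  fixes n :: nat and c :: "nat \<Rightarrow> complex" and D :: "l2 set" and H :: "l2 \<Rightarrow> l2"
    and z :: complex and k :: real
  assumes "n > 0" and "even n"
    and "Re (c n) > 0" and "Im (c n) > 0"
    and "closed_schrodinger_extension n c D H"
    and "0 < Arg z" and "Arg z < Arg (c n)"
    and "k > 0"
  shows "((\<lambda>\<sigma>::real. ereal (\<sigma> powr (- k)) * resolvent_norm D H (of_real \<sigma> * z))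
           \<longlongrightarrow> \<infinity>) at_top"
proof -
  obtain m where n: "n = 2 * m" "m > 0" using assms(1,2) by (auto elim: evenE)
  \<comment> \<open>More than enough: \<open>\<epsilon> ^ -(j + 2) \<ge> r ^ (j + 2)\<close> has to exceed \<open>\<sigma> powr (k + 1)\<close>.\<close>
  define j where "j = nat \<lceil>2 * n * (k + 1)\<rceil>"
  define d where "d = (m + 1) * (j + 2)"
  have "2 * n * (k + 1) \<le> j" unfolding j_def by linarith
  moreover have "real j + 1 \<le> d" by (simp add: d_def algebra_simps)
  ultimately have d: "2 * n * k + 2 * n + 1 \<le> d" by (simp add: algebra_simps)
  obtain C where C: "C > 0" "\<forall>\<^sub>F r in at_top.
    ereal (C * r ^ d / r ^ (2 * n)) \<le> resolvent_norm D H (of_real (r ^ (2 * n)) * z)"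
    using resolvent_norm_ge_power[OF assms(5) n assms(4) Arg_less_imp[OF assms(6,7,4)], of j]
    unfolding d_def by blast
  define r where "r \<sigma> = \<sigma> powr (1 / (2 * n))" for \<sigma> :: real
  have r: "filterlim r at_top at_top"
    unfolding r_def[abs_def] using assms(1) by real_asymp
  have r\<sigma>: "r \<sigma> ^ (2 * n) = \<sigma>" if "\<sigma> > 0" for \<sigma>
    using that assms(1) by (simp add: r_def powr_powr flip: powr_realpow)
  have lower: "\<forall>\<^sub>F \<sigma> in at_top. ereal (C * r \<sigma>) \<le> ereal (\<sigma> powr (- k)) * resolvent_norm D H (of_real \<sigma> * z)"
    using filterlim_iff[THEN iffD1, OF r, rule_format, OF C(2)]
      filterlim_iff[THEN iffD1, OF r, rule_format, OF eventually_ge_at_top[of 1]] eventually_gt_at_top[of 0]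
  proof eventually_elim
    case (elim \<sigma>)
    have r0: "r \<sigma> > 0" using elim(2) by simp
    have "\<sigma> powr (- k) = (r \<sigma> powr (2 * n)) powr (- k)"
      using r\<sigma>[OF elim(3)] r0 by (simp flip: powr_realpow)
    then have "\<sigma> powr (- k) * (C * r \<sigma> ^ d / r \<sigma> ^ (2 * n)) =
        C * (r \<sigma> powr (- (2 * n * k)) * r \<sigma> powr d * r \<sigma> powr (- (2 * n)))"
      using r0 by (simp add: powr_powr powr_minus field_simps flip: powr_realpow)
    also have "\<dots> = C * r \<sigma> powr (d - 2 * n * k - 2 * n)"
      by (simp flip: powr_add add: algebra_simps)
    also have "\<dots> \<ge> C * r \<sigma> powr 1"
      using C(1) elim(2) d by (intro mult_left_mono powr_mono) auto
    finally have "ereal (C * r \<sigma>) \<le> ereal (\<sigma> powr (- k)) * ereal (C * r \<sigma> ^ d / r \<sigma> ^ (2 * n))"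
      using r0 by simp
    also have "\<dots> \<le> ereal (\<sigma> powr (- k)) * resolvent_norm D H (of_real \<sigma> * z)"
      using elim(1) r\<sigma>[OF elim(3)] by (intro ereal_mult_left_mono) auto
    finally show ?case .
  qed
  have "filterlim (\<lambda>\<sigma>. C * r \<sigma>) at_top at_top"
    by (rule filterlim_tendsto_pos_mult_at_top[OF tendsto_const C(1) r])
  then have large: "\<forall>\<^sub>F \<sigma> in at_top. M < C * r \<sigma>" for M
    by (simp add: filterlim_at_top_dense)
  show ?thesis
    unfolding tendsto_PInfty
  proof
    fix M
    show "\<forall>\<^sub>F \<sigma> in at_top. ereal M < ereal (\<sigma> powr (- k)) * resolvent_norm D H (of_real \<sigma> * z)"
      using lower large[of M] by eventually_elim (rule less_le_trans[rotated], assumption, simp)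
  qed
qed

end
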